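(* Suppose that $\mathbb F=(\mathcal F_t)_{t\ge0}$ is a filtration that is augmented and left-continuous. Let $(M_t)_{t\ge 0}$ be a convex and integrably bounded set-valued $\mathbb F$-submartingale such that $t\mapsto s(x^*,\mathbb E[M_t])$ is left-continuous for every $x^*\in\mathscr W$. Then it has a Hausdorff càglàd modification $(\tilde M_t)_{t\ge 0}$, i.e., there is a convex and integrably bounded set-valued $\mathbb F$-submartingale $(\tilde M_t)_{t\ge 0}$ with $\mathbb P\{M_t=\tilde M_t\}=1$ for every $t\ge 0$ such that the following properties hold with probability one: (a) $\tilde M_{t-}$ exists and $\tilde M_{t-}=\tilde M_t$ for every $t>0$; (b) $\tilde M_{t+}$ exists for every $t\ge 0$. If, in addition, $(M_t)_{t\ge 0}$ is a set-valued $\mathbb F$-martingale, then so is $(\tilde M_t)_{t\ge 0}$.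
   Context: Sets. $\mathbb R^d$ carries the Euclidean inner product $\langle\cdot,\cdot\rangle$ and norm $|\cdot|$; $\mathbb B=\{x\in\mathbb R^d: |x|\le 1\}$. For nonempty closed $C,D\subseteq\mathbb R^d$: $d(x,C)=\inf_{y\in C}|x-y|$; the Hausdorff distance is $h(C,D)=\max\{\sup_{x\in C}d(x,D),\sup_{y\in D}d(y,C)\}$; $\|C\|=\sup_{x\in C}|x|$; the support function is $s(x^*,C)=\sup_{x\in C}\langle x^*,x\rangle$. "Hausdorff" limits and continuity are with respect to $h$. $\mathscr W$ is a fixed countable dense subset of $\mathbb B$ with $0\notin\mathscr W$. Set-valued random variables. $(\Omega,\mathcal F,\mathbb P)$ is a probability space, $\mathcal G\subseteq\mathcal F$ a sub-$\sigma$-algebra. A map $\Xi$ from $\Omega$ to the nonempty closed subsets of $\mathbb R^d$ is $\mathcal G$-measurable if $\{\omega:\Xi(\omega)\cap C\ne\emptyset\}\in\mathcal G$ for all closed $C$; such maps are identified up to a.s. equality. $S^1_{\mathcal G}(\Xi)$ is the set of $\mathcal G$-measurable integrable random vectors $\xi$ with $\xi\in\Xi$ a.s. $\Xi$ is integrable if $S^1_{\mathcal F}(\Xi)\neq\emptyset$ and integrably bounded if $\mathbb E[\|\Xi\|]<\infty$. $\mathbb E[\Xi]$ is the closure in $\mathbb R^d$ of $\{\mathbb E[\xi]:\xi\in S^1_{\mathcal F}(\Xi)\}$. $\mathbb E[\Xi|\mathcal G]$ is the a.s. unique $\mathcal G$-measurable integrable set-valued random variable such that $S^1_{\mathcal G}(\mathbb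 E[\Xi|\mathcal G])$ is the $L^1$-closure of $\{\mathbb E[\xi|\mathcal G]:\xi\in S^1_{\mathcal F}(\Xi)\}$. Processes. A set-valued process $(M_t)_{t\ge0}$ is a family of $\mathcal F$-measurable (closed nonempty valued) set-valued random variables; it is $\mathbb F$-adapted if each $M_t$ is $\mathcal F_t$-measurable, convex if each $M_t$ has convex values, integrable (integrably bounded) if each $M_t$ is. An $\mathbb F$-adapted integrable set-valued process is a set-valued $\mathbb F$-submartingale if $\mathbb E[M_t|\mathcal F_s]\supseteq M_s$ a.s. for all $s\le t$, and a set-valued $\mathbb F$-martingale if equality holds a.s. for all $s\le t$. Augmented: complete, with all $\mathbb P$-null sets in $\mathcal F_0$. Left-continuous: $\mathcal F_t=\sigma(\bigcup_{r<t}\mathcal F_r)$ for each $t>0$. "Càglàd" means left-continuous and right-limited. One-sided limits. For a set-valued process $(N_t)_{t\ge0}$, $N_{t-}=\lim_{r\in\mathbb Q,\,r\uparrow t}N_r$ ($t>0$) and $N_{t+}=\lim_{r\in\mathbb Q,\,r\downarrow t}N_r$ ($t\ge0$), in the Hausdorff sense. *)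

theory Defs
  imports "HOL-Probability.Probability"
begin

section \<open>Closed sets and the Hausdorff distance\<close>

text \<open>These quantities may be infinite for unbounded sets, hence the extended codomains.\<close>

definition hausdorff_distance :: "'a::euclidean_space set \<Rightarrow> 'a set \<Rightarrow> ennreal" where
  "hausdorff_distance C D =
     max (SUP x\<in>C. ennreal (infdist x D)) (SUP y\<in>D. ennreal (infdist y C))"

definition set_norm :: "'a::euclidean_space set \<Rightarrow> ennreal" where
  "set_norm C = (SUP x\<in>C. ennreal (norm x))"

definition support_fun :: "'a::euclidean_space \<Rightarrow> 'a set \<Rightarrow> ereal" where
  "support_fun x C = (SUP y\<in>C. ereal (x \<bullet> y))"

definition hausdorff_tendsto ::
    "('b \<Rightarrow> 'a::euclidean_space set) \<Rightarrow> 'a set \<Rightarrow> 'b filter \<Rightarrow> bool" where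
  "hausdorff_tendsto N L \<FF> \<longleftrightarrow>
     closed L \<and> L \<noteq> {} \<and> ((\<lambda>r. hausdorff_distance (N r) L) \<longlongrightarrow> 0) \<FF>"

text \<open>One-sided limits at \<open>t\<close> of a set-valued path on \<open>[0,\<infinity>)\<close>, along the rationals;
  the left limit is meaningful for \<open>t > 0\<close> only.\<close>

definition has_left_limit :: "(real \<Rightarrow> 'a::euclidean_space set) \<Rightarrow> real \<Rightarrow> 'a set \<Rightarrow> bool" where
  "has_left_limit N t L \<longleftrightarrow> hausdorff_tendsto N L (at t within {r \<in> \<rat>. 0 \<le> r \<and> r < t})"

definition has_right_limit :: "(real \<Rightarrow> 'a::euclidean_space set) \<Rightarrow> real \<Rightarrow> 'a set \<Rightarrow> bool" where
  "has_right_limit N t L \<longleftrightarrow> hausdorff_tendsto N L (at t within {r \<in> \<rat>. t < r})"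


section \<open>Set-valued random variables\<close>

text \<open>Throughout, \<open>M\<close> is the underlying probability space; sub-\<open>\<sigma>\<close>-algebras of it are given as
  measures \<open>G\<close> with \<open>subalgebra M G\<close>, of which only \<open>space G\<close> and \<open>sets G\<close> matter.\<close>

definition set_random_variable :: "'w measure \<Rightarrow> ('w \<Rightarrow> 'a::euclidean_space set) \<Rightarrow> bool" where
  "set_random_variable G \<Xi> \<longleftrightarrow>
     (\<forall>\<omega>\<in>space G. closed (\<Xi> \<omega>) \<and> \<Xi> \<omega> \<noteq> {}) \<and>
     (\<forall>C. closed C \<longrightarrow> {\<omega>\<in>space G. \<Xi> \<omega> \<inter> C \<noteq> {}} \<in> sets G)"

definition integrable_selections ::
    "'w measure \<Rightarrow> 'w measure \<Rightarrow> ('w \<Rightarrow> 'a::euclidean_space set) \<Rightarrow> ('w \<Rightarrow> 'a) set" where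
  "integrable_selections M G \<Xi> =
     {\<xi> \<in> borel_measurable G. integrable M \<xi> \<and> (AE \<omega> in M. \<xi> \<omega> \<in> \<Xi> \<omega>)}"

definition set_integrable_rv :: "'w measure \<Rightarrow> ('w \<Rightarrow> 'a::euclidean_space set) \<Rightarrow> bool" where
  "set_integrable_rv M \<Xi> \<longleftrightarrow> integrable_selections M M \<Xi> \<noteq> {}"

definition integrably_bounded_rv :: "'w measure \<Rightarrow> ('w \<Rightarrow> 'a::euclidean_space set) \<Rightarrow> bool" where
  "integrably_bounded_rv M \<Xi> \<longleftrightarrow> (\<integral>\<^sup>+\<omega>. set_norm (\<Xi> \<omega>) \<partial>M) < \<infinity>"

definition set_expectation :: "'w measure \<Rightarrow> ('w \<Rightarrow> 'a::euclidean_space set) \<Rightarrow> 'a set" where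
  "set_expectation M \<Xi> = closure ((\<lambda>\<xi>. integral\<^sup>L M \<xi>) ` integrable_selections M M \<Xi>)"

text \<open>Conditional expectation of an integrable random vector, coordinate by coordinate.\<close>

definition vec_cond_exp ::
    "'w measure \<Rightarrow> 'w measure \<Rightarrow> ('w \<Rightarrow> 'a::euclidean_space) \<Rightarrow> 'w \<Rightarrow> 'a" where
  "vec_cond_exp M G \<xi> \<omega> = (\<Sum>b\<in>Basis. real_cond_exp M G (\<lambda>\<omega>. \<xi> \<omega> \<bullet> b) \<omega> *\<^sub>R b)"

text \<open>The closure is taken in the space of \<open>G\<close>-measurable integrable random vectors.\<close>

definition L1_closure ::
    "'w measure \<Rightarrow> 'w measure \<Rightarrow> ('w \<Rightarrow> 'a::euclidean_space) set \<Rightarrow> ('w \<Rightarrow> 'a) set" where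
  "L1_closure M G A =
     {\<eta> \<in> borel_measurable G. integrable M \<eta> \<and>
        (\<forall>e>0. \<exists>\<zeta>\<in>A. (\<integral>\<omega>. norm (\<eta> \<omega> - \<zeta> \<omega>) \<partial>M) < e)}"

text \<open>\<open>Y\<close> is a version of \<open>\<E>[\<Xi>|G]\<close>. Versions are unique only up to almost sure equality, so
  almost sure statements about \<open>\<E>[\<Xi>|G]\<close> are made for some version of it.\<close>

definition is_set_cond_exp ::
    "'w measure \<Rightarrow> 'w measure \<Rightarrow> ('w \<Rightarrow> 'a::euclidean_space set) \<Rightarrow> ('w \<Rightarrow> 'a set) \<Rightarrow> bool" where
  "is_set_cond_exp M G \<Xi> Y \<longleftrightarrow>
     set_random_variable G Y \<and> set_integrable_rv M Y \<and>
     integrable_selections M G Y =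
       L1_closure M G (vec_cond_exp M G ` integrable_selections M M \<Xi>)"


section \<open>Filtrations and set-valued processes indexed by \<open>[0,\<infinity>)\<close>\<close>

text \<open>The index type is \<^typ>\<open>real\<close>; values at negative times are irrelevant.\<close>

definition filtration_nonneg :: "'w measure \<Rightarrow> (real \<Rightarrow> 'w measure) \<Rightarrow> bool" where
  "filtration_nonneg M F \<longleftrightarrow>
     (\<forall>t\<ge>0. subalgebra M (F t)) \<and>
     (\<forall>s t. 0 \<le> s \<and> s \<le> t \<longrightarrow> sets (F s) \<subseteq> sets (F t))"

definition augmented :: "'w measure \<Rightarrow> (real \<Rightarrow> 'w measure) \<Rightarrow> bool" where
  "augmented M F \<longleftrightarrow> complete_measure M \<and> null_sets M \<subseteq> sets (F 0)"

definition left_continuous_filtration :: "'w measure \<Rightarrow> (real \<Rightarrow> 'w measure) \<Rightarrow> bool" where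
  "left_continuous_filtration M F \<longleftrightarrow>
     (\<forall>t>0. sets (F t) = sigma_sets (space M) (\<Union>r\<in>{0..<t}. sets (F r)))"

definition adapted_set_process ::
    "(real \<Rightarrow> 'w measure) \<Rightarrow> (real \<Rightarrow> 'w \<Rightarrow> 'a::euclidean_space set) \<Rightarrow> bool" where
  "adapted_set_process F X \<longleftrightarrow> (\<forall>t\<ge>0. set_random_variable (F t) (X t))"

definition convex_set_process ::
    "'w measure \<Rightarrow> (real \<Rightarrow> 'w \<Rightarrow> 'a::euclidean_space set) \<Rightarrow> bool" where
  "convex_set_process M X \<longleftrightarrow> (\<forall>t\<ge>0. \<forall>\<omega>\<in>space M. convex (X t \<omega>))"

definition integrable_set_process ::
    "'w measure \<Rightarrow> (real \<Rightarrow> 'w \<Rightarrow> 'a::euclidean_space set) \<Rightarrow> bool" where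
  "integrable_set_process M X \<longleftrightarrow> (\<forall>t\<ge>0. set_integrable_rv M (X t))"

definition integrably_bounded_set_process ::
    "'w measure \<Rightarrow> (real \<Rightarrow> 'w \<Rightarrow> 'a::euclidean_space set) \<Rightarrow> bool" where
  "integrably_bounded_set_process M X \<longleftrightarrow> (\<forall>t\<ge>0. integrably_bounded_rv M (X t))"

definition set_submartingale ::
    "'w measure \<Rightarrow> (real \<Rightarrow> 'w measure) \<Rightarrow> (real \<Rightarrow> 'w \<Rightarrow> 'a::euclidean_space set) \<Rightarrow> bool" where
  "set_submartingale M F X \<longleftrightarrow>
     adapted_set_process F X \<and> integrable_set_process M X \<and>
     (\<forall>s t. 0 \<le> s \<and> s \<le> t \<longrightarrow>
        (\<exists>Y. is_set_cond_exp M (F s) (X t) Y \<and> (AE \<omega> in M. X s \<omega> \<subseteq> Y \<omega>)))"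

definition set_martingale ::
    "'w measure \<Rightarrow> (real \<Rightarrow> 'w measure) \<Rightarrow> (real \<Rightarrow> 'w \<Rightarrow> 'a::euclidean_space set) \<Rightarrow> bool" where
  "set_martingale M F X \<longleftrightarrow>
     adapted_set_process F X \<and> integrable_set_process M X \<and>
     (\<forall>s t. 0 \<le> s \<and> s \<le> t \<longrightarrow>
        (\<exists>Y. is_set_cond_exp M (F s) (X t) Y \<and> (AE \<omega> in M. Y \<omega> = X s \<omega>)))"

end

theory Submission
  imports Defs
begin

text \<open>For every \<open>x\<close> the support process \<open>t \<mapsto> s(x, M\<^sub>t)\<close> is a real submartingale, so by the
  upcrossing inequality almost every one of its paths is locally bounded and has one-sided limits
  along the rationals. By left continuity of the filtration and of the expectations,
  \<open>s(x, M\<^sub>r) \<longlongrightarrow> s(x, M\<^sub>t)\<close> in \<open>L\<^sup>1\<close> as \<open>r \<rightarrow> t-\<close>, so the left limit at \<open>t\<close> is almost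
  surely \<open>s(x, M\<^sub>t)\<close>. For convex sets inside a common ball, convergence of the support functions
  on a dense set of directions amounts to Hausdorff convergence. Hence the Hausdorff left limits of
  \<open>M\<close> exist simultaneously at all \<open>t\<close>, and they form the modification.\<close>

section \<open>Upcrossings of paths\<close>

text \<open>The obstacle is that the exceptional null set must not depend on the time. Everything
  required of a path is therefore reduced to countably many conditions, indexed by rational
  thresholds a < b, directions in \<open>W\<close> and natural horizons T. They are collected in
  \<open>regular\<close> and give one-sided limits at all times at once. Only the identity of the
  left limit with \<open>X t\<close> is proved for one t at a time, which is why the limits agree
  with \<open>X\<close> up to modification. The upcrossing inequality controls paths from above
  only. This is enough for a two-sided bound, since a bound on s(-u, C) bounds the points of C from
  below in direction u. The coordinate directions used for this need not lie in \<open>W\<close>, so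
  the support process is shown to be a submartingale for every x. Set-valued expectations and
  conditional expectations are defined through selections. Support functions are recovered from them
  by measurable selections that almost attain the supremum.\<close>

fun upcrosses :: "(real \<Rightarrow> real) \<Rightarrow> real \<Rightarrow> real \<Rightarrow> real set \<Rightarrow> nat \<Rightarrow> real \<Rightarrow> bool" where
  "upcrosses f a b D 0 s = True"
| "upcrosses f a b D (Suc m) s =
     (\<exists>q\<in>D. \<exists>r\<in>D. s \<le> q \<and> q < r \<and> f q < a \<and> b < f r \<and> upcrosses f a b D m r)"

lemma upcrosses_mono: "upcrosses f a b D m s \<Longrightarrow> D \<subseteq> E \<Longrightarrow> upcrosses f a b E m s"
  by (induction m arbitrary: s) (simp, fastforce)

lemma upcrosses_antimono_start: "upcrosses f a b D m s \<Longrightarrow> s' \<le> s \<Longrightarrow> upcrosses f a b D m s'"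
  by (cases m) (auto, meson order_trans)

text \<open>Having at least m upcrossings asserts the existence of 2m time points, and finitely many
  points of an increasing union lie in one member. The recursion in \<open>upcrosses\<close> is
  existential for this reason: it makes sense for infinite time sets and commutes with increasing
  unions.\<close>

lemma upcrosses_UN:
  assumes "incseq D" "upcrosses f a b (\<Union>n. D n) m s"
  shows "\<exists>n. upcrosses f a b (D n) m s"
  using assms(2)
proof (induction m arbitrary: s)
  case (Suc m)
  then obtain q r i j where qr: "q \<in> D i" "r \<in> D j" "s \<le> q" "q < r" "f q < a" "b < f r"
    "upcrosses f a b (\<Union>n. D n) m r" by auto
  then obtain k where k: "upcrosses f a b (D k) m r" using Suc.IH by blast
  let ?n = "max i (max j k)"
  have "D i \<subseteq> D ?n" "D j \<subseteq> D ?n" "D k \<subseteq> D ?n"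
    using \<open>incseq D\<close> by (auto simp: incseq_def)
  then have "upcrosses f a b (D ?n) (Suc m) s"
    using qr upcrosses_mono[OF k] by (simp, meson subsetD)
  then show ?case by blast
qed auto

section \<open>Counting upcrossings of a sequence\<close>

fun in_upcrossing :: "real \<Rightarrow> real \<Rightarrow> (nat \<Rightarrow> real) \<Rightarrow> nat \<Rightarrow> bool" where
  "in_upcrossing a b x 0 = (x 0 < a)"
| "in_upcrossing a b x (Suc n) =
     (if in_upcrossing a b x n then x (Suc n) \<le> b else x (Suc n) < a)"

fun upcrossings :: "real \<Rightarrow> real \<Rightarrow> (nat \<Rightarrow> real) \<Rightarrow> nat \<Rightarrow> nat" where
  "upcrossings a b x 0 = 0"
| "upcrossings a b x (Suc n) =
     upcrossings a b x n + (if in_upcrossing a b x n \<and> b < x (Suc n) then 1 else 0)"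

lemma upcrossings_mono: "i \<le> j \<Longrightarrow> upcrossings a b x i \<le> upcrossings a b x j"
  by (induction rule: dec_induct) auto

text \<open>Doob's betting argument for a single path: one unit is held during the step from k to
  Suc k exactly when \<open>in_upcrossing\<close> holds at k. This state depends only on the values
  up to index k, so the strategy is predictable.\<close>

lemma upcrossings_gain:
  fixes x :: "nat \<Rightarrow> real"
  assumes "a < b"
  shows "(b - a) * real (upcrossings a b x n) \<le>
    (\<Sum>k<n. of_bool (in_upcrossing a b x k) * (x (Suc k) - x k)) + max 0 (a - x n)"
proof -
  let ?G = "\<lambda>n. \<Sum>k<n. of_bool (in_upcrossing a b x k) * (x (Suc k) - x k)"
  \<comment> \<open>Invariant of the strategy: each completed upcrossing has earned at least b - a,
    and an open position, entered below a, is worth at least x n - a. If that value is negative, it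
    is the loss covered by max 0 (a - x n).\<close>
  have "(b - a) * real (upcrossings a b x n) + (if in_upcrossing a b x n then x n - a else 0) \<le> ?G n"
  proof (induction n)
    case (Suc n)
    then show ?case using assms by (auto simp: algebra_simps split: if_splits)
  qed simp
  then show ?thesis by (auto split: if_splits)
qed

text \<open>The greedy count misses no crossing: a value below a puts the state into
  \<open>in_upcrossing\<close>, a value above b makes the state false, and the state can be left
  only by adding one to the count.\<close>

lemma upcrossings_Suc_le:
  assumes "a < b" "i < j" "x i < a" "b < x j"
  shows "Suc (upcrossings a b x i) \<le> upcrossings a b x j"
proof -
  have i: "in_upcrossing a b x i" using assms by (cases i) auto
  have "in_upcrossing a b x k \<or> Suc (upcrossings a b x i) \<le> upcrossings a b x k" if "i \<le> k" for k
    using that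
  proof (induction rule: dec_induct)
    case (step n)
    then show ?case using upcrossings_mono[OF step(1), of a b x]
      by (cases "b < x (Suc n)") auto
  qed (use i in auto)
  moreover have "\<not> in_upcrossing a b x j" using assms by (cases j) auto
  ultimately show ?thesis using assms(2) less_imp_le by blast
qed

text \<open>The factorial denominators make the grids increasing in \<open>n\<close>.\<close>

definition grid :: "nat \<Rightarrow> nat \<Rightarrow> real set" where
  "grid T n = (\<lambda>k. real k / fact n) ` {..T * fact n}"

lemma incseq_grid: "incseq (grid T)"
proof (rule incseq_SucI, rule subsetI)
  fix n x assume "x \<in> grid T n"
  then obtain k where k: "k \<le> T * fact n" "x = real k / fact n" by (auto simp: grid_def)
  have "x = real (k * Suc n) / fact (Suc n)"
    by (simp only: k(2) of_nat_mult fact_Suc mult.commute[of "of_nat (Suc n)"]) simp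
  moreover have "k * Suc n \<le> T * fact (Suc n)" using mult_le_mono1[OF k(1), of "Suc n"] by (simp add: algebra_simps)
  ultimately show "x \<in> grid T (Suc n)" unfolding grid_def by blast
qed

text \<open>A fraction with denominator n also has denominator n!, so a rational m / n in the
  interval already appears in the n-th grid.\<close>

lemma UN_grid: "(\<Union>n. grid T n) = \<rat> \<inter> {0..real T}"
proof (intro equalityI subsetI)
  fix x assume "x \<in> (\<Union>n. grid T n)"
  then obtain k n where k: "k \<le> T * fact n" "x = real k / fact n" by (auto simp: grid_def)
  have "real k \<le> real (T * fact n)" using k(1) of_nat_le_iff by blast
  then have "x \<le> T" unfolding k(2) by (simp add: field_simps)
  moreover have "x \<in> \<rat>" unfolding k(2) using Rats_of_nat[of "fact n"] by (intro Rats_divide Rats_of_nat) simp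
  ultimately show "x \<in> \<rat> \<inter> {0..real T}" using k by auto
next
  fix x assume x: "x \<in> \<rat> \<inter> {0..real T}"
  then obtain m n :: nat where mn: "n \<noteq> 0" "\<bar>x\<bar> = real m / real n"
    using Rats_abs_nat_div_natE by blast
  then have "n dvd fact n" by (simp add: dvd_fact)
  then obtain c where c: "fact n = n * c" by blast
  then have "c \<noteq> 0" by (metis fact_nonzero mult_0_right)
  have "(fact n :: real) = real n * real c" using c by (metis of_nat_fact of_nat_mult)
  then have eq: "x = real (m * c) / fact n" using x mn \<open>c \<noteq> 0\<close> by (simp add: field_simps)
  have "real (m * c) \<le> real (T * fact n)" using x by (simp add: eq field_simps)
  then have "m * c \<le> T * fact n" by (simp only: of_nat_le_iff)
  then have "x \<in> grid T n" unfolding grid_def using eq by blast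
  then show "x \<in> (\<Union>n. grid T n)" by blast
qed

text \<open>Bridge between the two notions: any chain of m upcrossings with times in the grid is
  dominated by the greedy count along the grid. The start index i is arbitrary so that the induction
  can restart at the end of the crossing just found.\<close>

lemma upcrosses_grid_le_upcrossings:
  assumes "a < b" "upcrosses f a b (grid T n) m s" "real i / fact n \<le> s" "i \<le> T * fact n"
  shows "upcrossings a b (\<lambda>k. f (real k / fact n)) i + m
    \<le> upcrossings a b (\<lambda>k. f (real k / fact n)) (T * fact n)"
  using assms(2-)
proof (induction m arbitrary: s i)
  case 0
  then show ?case by (simp add: upcrossings_mono)
next
  case (Suc m)
  let ?u = "upcrossings a b (\<lambda>k. f (real k / fact n))"
  obtain k j where kj: "s \<le> real k / fact n" "real k / fact n < real j / fact n" "k \<le> T * fact n"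
    "j \<le> T * fact n" "f (real k / fact n) < a" "b < f (real j / fact n)"
    "upcrosses f a b (grid T n) m (real j / fact n)"
    using Suc.prems(1) by (auto simp: grid_def)
  have "real i / fact n \<le> real k / fact n" using kj Suc.prems by linarith
  then have "i \<le> k" "k < j" using kj(2) by (auto simp: divide_le_cancel divide_less_cancel)
  then have "Suc (?u i) \<le> ?u j"
    using upcrossings_Suc_le[OF assms(1), of k j "\<lambda>k. f (real k / fact n)"] kj
      upcrossings_mono[of i k a b] by (meson Suc_le_mono order_trans)
  moreover have "?u j + m \<le> ?u (T * fact n)" using Suc.IH[OF kj(7) _ kj(4)] by simp
  ultimately show ?case by simp
qed

section \<open>From finitely many upcrossings to one-sided limits along the rationals\<close>

lemma frequently_at_left_ratsD:
  fixes s t :: real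
  assumes "\<exists>\<^sub>F r in at t within {r\<in>\<rat>. 0 \<le> r \<and> r < t}. P r" "s < t"
  shows "\<exists>r\<in>\<rat>. 0 \<le> r \<and> s < r \<and> r < t \<and> P r"
proof -
  have "\<forall>\<^sub>F r in at t within {r\<in>\<rat>. 0 \<le> r \<and> r < t}. s < r"
    by (rule order_tendstoD(1)[OF tendsto_ident_at assms(2)])
  moreover have "\<forall>\<^sub>F r in at t within {r\<in>\<rat>. 0 \<le> r \<and> r < t}. r \<in> {r\<in>\<rat>. 0 \<le> r \<and> r < t}"
    by (simp add: eventually_at_filter)
  ultimately have "\<exists>\<^sub>F r in at t within {r\<in>\<rat>. 0 \<le> r \<and> r < t}. P r \<and> (s < r \<and> r \<in> {r\<in>\<rat>. 0 \<le> r \<and> r < t})"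
    by (intro frequently_eventually_frequently[OF assms(1)] eventually_conj)
  from frequently_ex[OF this] show ?thesis by blast
qed

lemma frequently_at_right_ratsD:
  fixes s t :: real
  assumes "\<exists>\<^sub>F r in at t within {r\<in>\<rat>. t < r}. P r" "t < s"
  shows "\<exists>r\<in>\<rat>. t < r \<and> r < s \<and> P r"
proof -
  have "\<forall>\<^sub>F r in at t within {r\<in>\<rat>. t < r}. r < s"
    by (rule order_tendstoD(2)[OF tendsto_ident_at assms(2)])
  moreover have "\<forall>\<^sub>F r in at t within {r\<in>\<rat>. t < r}. r \<in> {r\<in>\<rat>. t < r}"
    by (simp add: eventually_at_filter)
  ultimately have "\<exists>\<^sub>F r in at t within {r\<in>\<rat>. t < r}. P r \<and> (r < s \<and> r \<in> {r\<in>\<rat>. t < r})"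
    by (intro frequently_eventually_frequently[OF assms(1)] eventually_conj)
  from frequently_ex[OF this] show ?thesis by blast
qed

lemma at_left_rats_neq_bot:
  fixes t :: real
  assumes "0 < t" shows "at t within {r\<in>\<rat>. 0 \<le> r \<and> r < t} \<noteq> bot"
proof
  assume *: "at t within {r\<in>\<rat>. 0 \<le> r \<and> r < t} = bot"
  have "\<exists>d>0. \<forall>x\<in>{r\<in>\<rat>. 0 \<le> r \<and> r < t}. x \<noteq> t \<and> dist x t < d \<longrightarrow> False"
    using * eventually_at[of "\<lambda>_. False" t "{r\<in>\<rat>. 0 \<le> r \<and> r < t}"] by simp
  then obtain d where d: "d > 0" "\<And>x. x \<in> \<rat> \<Longrightarrow> 0 \<le> x \<Longrightarrow> x < t \<Longrightarrow> \<not> dist x t < d" by auto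
  obtain q where "q \<in> \<rat>" "max 0 (t - d) < q" "q < t"
    using Rats_dense_in_real[of "max 0 (t - d)" t] assms d(1) by auto
  then show False using d(2)[of q] by (auto simp: dist_real_def)
qed

lemma at_right_rats_neq_bot:
  fixes t :: real
  shows "at t within {r\<in>\<rat>. t < r} \<noteq> bot"
proof
  assume *: "at t within {r\<in>\<rat>. t < r} = bot"
  have "\<exists>d>0. \<forall>x\<in>{r\<in>\<rat>. t < r}. x \<noteq> t \<and> dist x t < d \<longrightarrow> False"
    using * eventually_at[of "\<lambda>_. False" t "{r\<in>\<rat>. t < r}"] by simp
  then obtain d where d: "d > 0" "\<And>x. x \<in> \<rat> \<Longrightarrow> t < x \<Longrightarrow> \<not> dist x t < d" by auto
  obtain q where "q \<in> \<rat>" "t < q" "q < t + d"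
    using Rats_dense_in_real[of t "t + d"] d(1) by auto
  then show False using d(2)[of q] by (auto simp: dist_real_def)
qed

text \<open>A gap between the lower and the upper limit contains two rationals a < b, between which
  f oscillates forever; without a gap, boundedness makes the common value finite. Rational
  thresholds keep the later exceptional sets countable in number.\<close>

lemma bounded_no_oscillation_tendsto:
  fixes f :: "'b \<Rightarrow> real"
  assumes "F \<noteq> bot" and bnd: "\<forall>\<^sub>F r in F. \<bar>f r\<bar> \<le> B"
    and osc: "\<And>a b. a \<in> \<rat> \<Longrightarrow> b \<in> \<rat> \<Longrightarrow> a < b \<Longrightarrow>
      \<not> ((\<exists>\<^sub>F r in F. f r < a) \<and> (\<exists>\<^sub>F r in F. b < f r))"
  shows "\<exists>l. (f \<longlongrightarrow> l) F"
proof -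
  let ?g = "\<lambda>r. ereal (f r)"
  have lo: "ereal (- B) \<le> Liminf F ?g"
    by (rule Liminf_bounded) (use bnd in \<open>eventually_elim, auto\<close>)
  have hi: "Limsup F ?g \<le> ereal B"
    by (rule Limsup_bounded) (use bnd in \<open>eventually_elim, auto\<close>)
  have le: "Liminf F ?g \<le> Limsup F ?g" by (rule Liminf_le_Limsup[OF assms(1)])
  have "\<not> Liminf F ?g < Limsup F ?g"
  proof
    assume "Liminf F ?g < Limsup F ?g"
    then obtain a where a: "Liminf F ?g < ereal (real_of_rat a)" "ereal (real_of_rat a) < Limsup F ?g"
      using ereal_dense3 by blast
    from ereal_dense3[OF a(2)] obtain b where
      b: "ereal (real_of_rat a) < ereal (real_of_rat b)" "ereal (real_of_rat b) < Limsup F ?g" by blast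
    have "\<exists>\<^sub>F r in F. f r < real_of_rat a"
    proof (rule ccontr)
      assume "\<not> ?thesis"
      then have "\<forall>\<^sub>F r in F. real_of_rat a \<le> f r" by (simp add: not_frequently not_less)
      then have "ereal (real_of_rat a) \<le> Liminf F ?g" by (intro Liminf_bounded) (simp add: eventually_mono)
      with a(1) show False by simp
    qed
    moreover have "\<exists>\<^sub>F r in F. real_of_rat b < f r"
    proof (rule ccontr)
      assume "\<not> ?thesis"
      then have "\<forall>\<^sub>F r in F. f r \<le> real_of_rat b" by (simp add: not_frequently not_less)
      then have "Limsup F ?g \<le> ereal (real_of_rat b)" by (intro Limsup_bounded) (simp add: eventually_mono)
      with b(2) show False by simp
    qed
    ultimately show False using osc[of "real_of_rat a" "real_of_rat b"] b(1) by auto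
  qed
  with le have eq: "Liminf F ?g = Limsup F ?g" by simp
  then have "\<bar>Limsup F ?g\<bar> \<noteq> \<infinity>" using lo hi by (cases "Limsup F ?g") auto
  then obtain l where l: "Limsup F ?g = ereal l" by (metis ereal_real)
  have "(?g \<longlongrightarrow> ereal l) F"
    using eq l by (subst tendsto_iff_Liminf_eq_Limsup[OF assms(1)]) simp
  then show ?thesis by auto
qed

lemma left_limit_if_finite_upcrossings:
  fixes f :: "real \<Rightarrow> real"
  assumes "0 < t" "t \<le> T"
    and "\<And>q. q \<in> \<rat> \<inter> {0..T} \<Longrightarrow> \<bar>f q\<bar> \<le> B"
    and fin: "\<And>a b. a \<in> \<rat> \<Longrightarrow> b \<in> \<rat> \<Longrightarrow> a < b \<Longrightarrow> \<exists>m. \<not> upcrosses f a b (\<rat> \<inter> {0..T}) m 0"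
  shows "\<exists>l. (f \<longlongrightarrow> l) (at t within {r\<in>\<rat>. 0 \<le> r \<and> r < t})"
proof (rule bounded_no_oscillation_tendsto[OF at_left_rats_neq_bot[OF assms(1)]])
  show "\<forall>\<^sub>F r in at t within {r \<in> \<rat>. 0 \<le> r \<and> r < t}. \<bar>f r\<bar> \<le> B"
    using assms(2,3) by (auto simp: eventually_at_filter)
next
  fix a b :: real assume ab: "a \<in> \<rat>" "b \<in> \<rat>" "a < b"
  let ?F = "at t within {r\<in>\<rat>. 0 \<le> r \<and> r < t}"
  show "\<not> ((\<exists>\<^sub>F r in ?F. f r < a) \<and> (\<exists>\<^sub>F r in ?F. b < f r))"
  proof
    assume *: "(\<exists>\<^sub>F r in ?F. f r < a) \<and> (\<exists>\<^sub>F r in ?F. b < f r)"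
    \<comment> \<open>To the right of any s < t there is still a value below a followed by a value
      above b before t, so crossings are appended in the direction of time.\<close>
    have "upcrosses f a b (\<rat> \<inter> {0..T}) m s" if "s < t" for m s
      using that
    proof (induction m arbitrary: s)
      case (Suc m)
      obtain q where q: "q \<in> \<rat>" "0 \<le> q" "s < q" "q < t" "f q < a"
        using frequently_at_left_ratsD * Suc.prems by blast
      obtain r where r: "r \<in> \<rat>" "0 \<le> r" "q < r" "r < t" "b < f r"
        using frequently_at_left_ratsD * q(4) by blast
      show ?case using q r Suc.IH[OF r(4)] assms(2)
        by (simp, intro bexI[of _ q] bexI[of _ r]) auto
    qed simp
    with fin[OF ab] assms(1) show False by blast
  qed
qed

lemma right_limit_if_finite_upcrossings:
  fixes f :: "real \<Rightarrow> real"
  assumes "0 \<le> t" "t < T"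
    and "\<And>q. q \<in> \<rat> \<inter> {0..T} \<Longrightarrow> \<bar>f q\<bar> \<le> B"
    and fin: "\<And>a b. a \<in> \<rat> \<Longrightarrow> b \<in> \<rat> \<Longrightarrow> a < b \<Longrightarrow> \<exists>m. \<not> upcrosses f a b (\<rat> \<inter> {0..T}) m 0"
  shows "\<exists>l. (f \<longlongrightarrow> l) (at t within {r\<in>\<rat>. t < r})"
proof (rule bounded_no_oscillation_tendsto[OF at_right_rats_neq_bot])
  have "\<forall>\<^sub>F r in at t within {r \<in> \<rat>. t < r}. r < T"
    by (rule order_tendstoD(2)[OF tendsto_ident_at assms(2)])
  moreover have "\<forall>\<^sub>F r in at t within {r \<in> \<rat>. t < r}. r \<in> {r \<in> \<rat>. t < r}"
    by (simp add: eventually_at_filter)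
  ultimately show "\<forall>\<^sub>F r in at t within {r \<in> \<rat>. t < r}. \<bar>f r\<bar> \<le> B"
    by eventually_elim (use assms(1,3) in auto)
next
  fix a b :: real assume ab: "a \<in> \<rat>" "b \<in> \<rat>" "a < b"
  let ?F = "at t within {r\<in>\<rat>. t < r}"
  show "\<not> ((\<exists>\<^sub>F r in ?F. f r < a) \<and> (\<exists>\<^sub>F r in ?F. b < f r))"
  proof
    assume *: "(\<exists>\<^sub>F r in ?F. f r < a) \<and> (\<exists>\<^sub>F r in ?F. b < f r)"
    \<comment> \<open>Oscillation towards t from the right produces crossings in reversed order:
      each new one is placed before the chain already built. Hence r is chosen first, below the
      start s of the chain, and then q below r.\<close>
    have "\<exists>s>t. s \<le> T \<and> upcrosses f a b (\<rat> \<inter> {0..T}) m s" for m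
    proof (induction m)
      case 0
      then show ?case using assms(2) by auto
    next
      case (Suc m)
      then obtain s where s: "t < s" "s \<le> T" "upcrosses f a b (\<rat> \<inter> {0..T}) m s" by blast
      obtain r where r: "r \<in> \<rat>" "t < r" "r < s" "b < f r"
        using frequently_at_right_ratsD * s(1) by blast
      obtain q where q: "q \<in> \<rat>" "t < q" "q < r" "f q < a"
        using frequently_at_right_ratsD * r(2) by blast
      have "upcrosses f a b (\<rat> \<inter> {0..T}) (Suc m) q"
        using q r s assms(1) upcrosses_antimono_start[OF s(3), of r]
        by (simp, intro bexI[of _ q] bexI[of _ r]) auto
      then show ?case using q r s by (intro exI[of _ q]) auto
    qed
    then show False using fin[OF ab] assms(1) upcrosses_antimono_start by (meson less_imp_le order_trans)
  qed
qed

section \<open>Real submartingales\<close>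

text \<open>The submartingale property is stated with integrals over events of the past instead of
  conditional expectations. This is the form that selections deliver and in which the upcrossing
  inequality and the L1 estimate consume it.\<close>

definition real_submartingale :: "'w measure \<Rightarrow> (real \<Rightarrow> 'w measure) \<Rightarrow> (real \<Rightarrow> 'w \<Rightarrow> real) \<Rightarrow> bool" where
  "real_submartingale M F Z \<longleftrightarrow>
     (\<forall>t\<ge>0. Z t \<in> borel_measurable (F t) \<and> integrable M (Z t)) \<and>
     (\<forall>s t A. 0 \<le> s \<and> s \<le> t \<and> A \<in> sets (F s) \<longrightarrow>
        (\<integral>\<omega>. indicator A \<omega> * Z s \<omega> \<partial>M) \<le> (\<integral>\<omega>. indicator A \<omega> * Z t \<omega> \<partial>M))"

lemma filtration_subalgebra_mono:
  assumes "filtration_nonneg M F" "0 \<le> s" "s \<le> t"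
  shows "subalgebra (F t) (F s)"
  using assms by (auto simp: filtration_nonneg_def subalgebra_def)

lemma
  assumes "filtration_nonneg M F" "real_submartingale M F Z" "0 \<le> t"
  shows real_submartingale_integrable: "integrable M (Z t)"
    and real_submartingale_measurable: "Z t \<in> borel_measurable M"
    and real_submartingale_adapted: "t \<le> u \<Longrightarrow> Z t \<in> borel_measurable (F u)"
  using assms measurable_from_subalg[OF filtration_subalgebra_mono[OF assms(1,3)]]
  by (auto simp: real_submartingale_def)

lemma in_upcrossing_measurable:
  assumes "filtration_nonneg M F" "real_submartingale M F Z" "mono \<tau>" "0 \<le> \<tau> 0"
  shows "Measurable.pred (F (\<tau> k)) (\<lambda>\<omega>. in_upcrossing a b (\<lambda>k. Z (\<tau> k) \<omega>) k)"
proof (induction k)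
  case 0
  have [measurable]: "Z (\<tau> 0) \<in> borel_measurable (F (\<tau> 0))"
    using real_submartingale_adapted[OF assms(1,2,4)] by simp
  show ?case by simp
next
  case (Suc k)
  have \<tau>: "0 \<le> \<tau> k" "\<tau> k \<le> \<tau> (Suc k)"
    using assms(3,4) by (auto intro: order_trans[OF _ monoD[OF assms(3)], of _ 0] monoD[OF assms(3)])
  then have [measurable]: "Z (\<tau> (Suc k)) \<in> borel_measurable (F (\<tau> (Suc k)))"
    using real_submartingale_adapted[OF assms(1,2), of "\<tau> (Suc k)"] by simp
  have [measurable]: "Measurable.pred (F (\<tau> (Suc k))) (\<lambda>\<omega>. in_upcrossing a b (\<lambda>k. Z (\<tau> k) \<omega>) k)"
    by (rule measurable_from_subalg[OF filtration_subalgebra_mono[OF assms(1) \<tau>] Suc])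
  show ?case by simp
qed

lemma upcrossings_measurable:
  assumes "filtration_nonneg M F" "real_submartingale M F Z" "mono \<tau>" "0 \<le> \<tau> 0"
  shows "(\<lambda>\<omega>. upcrossings a b (\<lambda>k. Z (\<tau> k) \<omega>) n) \<in> measurable M (count_space UNIV)"
proof (induction n)
  case (Suc n)
  have \<tau>: "0 \<le> \<tau> k" for k
    using assms(3,4) by (auto intro: order_trans[OF _ monoD[OF assms(3)], of _ 0])
  have [measurable]: "Measurable.pred M (\<lambda>\<omega>. in_upcrossing a b (\<lambda>k. Z (\<tau> k) \<omega>) n)"
    using measurable_from_subalg[OF _ in_upcrossing_measurable[OF assms]] assms(1) \<tau>
    by (auto simp: filtration_nonneg_def)
  have [measurable]: "Z (\<tau> (Suc n)) \<in> borel_measurable M"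
    by (rule real_submartingale_measurable[OF assms(1,2) \<tau>])
  note Suc[measurable]
  show ?case unfolding upcrossings.simps by measurable
qed simp

text \<open>The expected gain of the strategy is at most the expected total increment. Indeed the
  gain is the total increment minus the increments on the events \<open>A k\<close> of not holding;
  since \<open>A k\<close> lies in the sigma-algebra at time \<open>\<tau> k\<close>, the
  submartingale property makes these increments nonnegative in mean. The rest is the pathwise bound
  \<open>upcrossings_gain\<close>.\<close>

lemma Doob_upcrossing_inequality:
  assumes "prob_space M" and F: "filtration_nonneg M F" and Z: "real_submartingale M F Z"
    and "mono \<tau>" "0 \<le> \<tau> 0" "a < b"
  shows "(b - a) * (\<integral>\<omega>. real (upcrossings a b (\<lambda>k. Z (\<tau> k) \<omega>) n) \<partial>M) \<le>
    (\<integral>\<omega>. Z (\<tau> n) \<omega> \<partial>M) - (\<integral>\<omega>. Z (\<tau> 0) \<omega> \<partial>M) + (\<integral>\<omega>. max 0 (a - Z (\<tau> n) \<omega>) \<partial>M)"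
    and "integrable M (\<lambda>\<omega>. real (upcrossings a b (\<lambda>k. Z (\<tau> k) \<omega>) n))"
proof -
  interpret prob_space M by fact
  have \<tau>: "0 \<le> \<tau> k" "\<tau> k \<le> \<tau> (Suc k)" for k
    using assms(4,5) by (auto intro: order_trans[OF _ monoD[OF assms(4)], of _ 0] monoD[OF assms(4)])
  note int[simp, intro] = real_submartingale_integrable[OF F Z \<tau>(1)]
  define C where "C k \<omega> = (of_bool (in_upcrossing a b (\<lambda>k. Z (\<tau> k) \<omega>) k) :: real)" for k \<omega>
  define A where "A k = {\<omega>\<in>space M. \<not> in_upcrossing a b (\<lambda>k. Z (\<tau> k) \<omega>) k}" for k
  have sp: "space (F (\<tau> k)) = space M" for k
    using F \<tau> by (auto simp: filtration_nonneg_def subalgebra_def)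
  have A: "A k \<in> sets (F (\<tau> k))" "A k \<in> sets M" for k
  proof -
    note [measurable] = in_upcrossing_measurable[OF F Z assms(4,5)]
    have "{\<omega>\<in>space (F (\<tau> k)). \<not> in_upcrossing a b (\<lambda>k. Z (\<tau> k) \<omega>) k} \<in> sets (F (\<tau> k))"
      by measurable
    then show "A k \<in> sets (F (\<tau> k))" by (simp add: A_def sp)
    then show "A k \<in> sets M" using F \<tau>(1)[of k] by (auto simp: filtration_nonneg_def subalgebra_def)
  qed
  have C: "C k \<omega> = 1 - indicator (A k) \<omega>" if "\<omega> \<in> space M" for k \<omega>
    using that by (auto simp: C_def A_def indicator_def)
  have intA: "integrable M (\<lambda>\<omega>. indicator (A k) \<omega> * Z (\<tau> j) \<omega>)" for k j
    using integrable_real_mult_indicator[OF A(2) int] by (simp add: mult.commute)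
  let ?D = "\<lambda>k \<omega>. Z (\<tau> (Suc k)) \<omega> - Z (\<tau> k) \<omega>"
  let ?I = "\<lambda>k \<omega>. ?D k \<omega> - (indicator (A k) \<omega> * Z (\<tau> (Suc k)) \<omega> - indicator (A k) \<omega> * Z (\<tau> k) \<omega>)"
  have step: "(\<integral>\<omega>. ?I k \<omega> \<partial>M) \<le> (\<integral>\<omega>. ?D k \<omega> \<partial>M)" for k
  proof -
    have "(\<integral>\<omega>. indicator (A k) \<omega> * Z (\<tau> k) \<omega> \<partial>M) \<le> (\<integral>\<omega>. indicator (A k) \<omega> * Z (\<tau> (Suc k)) \<omega> \<partial>M)"
      using Z \<tau> A by (auto simp: real_submartingale_def)
    then show ?thesis using intA by simp
  qed
  note [measurable] = upcrossings_measurable[OF F Z assms(4,5)]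
  have bound: "real (upcrossings a b x k) \<le> real k" for x k
    by (induction k) auto
  show U: "integrable M (\<lambda>\<omega>. real (upcrossings a b (\<lambda>k. Z (\<tau> k) \<omega>) n))"
    by (rule integrable_const_bound[where B="real n"]) (use bound in auto)
  have mx: "integrable M (\<lambda>\<omega>. max 0 (a - Z (\<tau> n) \<omega>))" by (intro integrable_max) auto
  have "(b - a) * (\<integral>\<omega>. real (upcrossings a b (\<lambda>k. Z (\<tau> k) \<omega>) n) \<partial>M) =
      (\<integral>\<omega>. (b - a) * real (upcrossings a b (\<lambda>k. Z (\<tau> k) \<omega>) n) \<partial>M)" by simp
  also have "\<dots> \<le> (\<integral>\<omega>. (\<Sum>k<n. ?I k \<omega>) + max 0 (a - Z (\<tau> n) \<omega>) \<partial>M)"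
  proof (rule integral_mono)
    fix \<omega> assume w: "\<omega> \<in> space M"
    have "(\<Sum>k<n. ?I k \<omega>) = (\<Sum>k<n. C k \<omega> * ?D k \<omega>)"
      by (intro sum.cong refl) (simp add: C[OF w] algebra_simps)
    then show "(b - a) * real (upcrossings a b (\<lambda>k. Z (\<tau> k) \<omega>) n) \<le> (\<Sum>k<n. ?I k \<omega>) + max 0 (a - Z (\<tau> n) \<omega>)"
      using upcrossings_gain[OF assms(6), of "\<lambda>k. Z (\<tau> k) \<omega>" n] by (simp add: C_def)
  qed (use U mx intA in auto)
  also have "\<dots> = (\<Sum>k<n. \<integral>\<omega>. ?I k \<omega> \<partial>M) + (\<integral>\<omega>. max 0 (a - Z (\<tau> n) \<omega>) \<partial>M)"
    using mx intA by (subst Bochner_Integration.integral_add) (auto simp: Bochner_Integration.integral_sum)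
  also have "(\<Sum>k<n. \<integral>\<omega>. ?I k \<omega> \<partial>M) \<le> (\<Sum>k<n. \<integral>\<omega>. ?D k \<omega> \<partial>M)" by (intro sum_mono step)
  also have "\<dots> = (\<Sum>k<n. (\<integral>\<omega>. Z (\<tau> (Suc k)) \<omega> \<partial>M) - (\<integral>\<omega>. Z (\<tau> k) \<omega> \<partial>M))" by simp
  also have "\<dots> = (\<integral>\<omega>. Z (\<tau> n) \<omega> \<partial>M) - (\<integral>\<omega>. Z (\<tau> 0) \<omega> \<partial>M)"
    by (rule sum_lessThan_telescope)
  finally show "(b - a) * (\<integral>\<omega>. real (upcrossings a b (\<lambda>k. Z (\<tau> k) \<omega>) n) \<partial>M) \<le>
    (\<integral>\<omega>. Z (\<tau> n) \<omega> \<partial>M) - (\<integral>\<omega>. Z (\<tau> 0) \<omega> \<partial>M) + (\<integral>\<omega>. max 0 (a - Z (\<tau> n) \<omega>) \<partial>M)" by simp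
qed

lemma upcrosses_measurable:
  assumes "countable D" "\<And>q. q \<in> D \<Longrightarrow> Z q \<in> borel_measurable M"
  shows "Measurable.pred M (\<lambda>\<omega>. upcrosses (\<lambda>q. Z q \<omega>) a b D m s)"
proof (induction m arbitrary: s)
  case (Suc m)
  note Suc[measurable] assms(2)[measurable]
  have "Measurable.pred M (\<lambda>\<omega>. s \<le> q \<and> q < r \<and> Z q \<omega> < a \<and> b < Z r \<omega> \<and> upcrosses (\<lambda>q. Z q \<omega>) a b D m r)"
    if "q \<in> D" "r \<in> D" for q r using that by measurable
  then show ?case unfolding upcrosses.simps pred_def
    by (intro sets.sets_Collect_countable_Ex' assms(1)) auto
qed simp

text \<open>Markov's inequality for the greedy count on each grid. Every grid starts at 0 and ends
  at T, so the bound from Doob's inequality is the same for all n and survives the passage to all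
  rationals of the interval by continuity from below.\<close>

lemma prob_upcrosses_le:
  assumes "prob_space M" and F: "filtration_nonneg M F" and Z: "real_submartingale M F Z" and "a < b"
  shows "(b - a) * (real m * measure M {\<omega>\<in>space M. upcrosses (\<lambda>q. Z q \<omega>) a b (\<rat> \<inter> {0..real T}) m 0}) \<le>
    (\<integral>\<omega>. Z T \<omega> \<partial>M) - (\<integral>\<omega>. Z 0 \<omega> \<partial>M) + (\<integral>\<omega>. max 0 (a - Z T \<omega>) \<partial>M)" (is "_ \<le> ?K")
proof -
  interpret prob_space M by fact
  define E where "E D = {\<omega>\<in>space M. upcrosses (\<lambda>q. Z q \<omega>) a b D m 0}" for D
  have nonneg: "0 \<le> q" if "q \<in> grid T n" for q n using that by (auto simp: grid_def)
  have E_meas: "E (grid T n) \<in> sets M" for n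
  proof -
    have "Measurable.pred M (\<lambda>\<omega>. upcrosses (\<lambda>q. Z q \<omega>) a b (grid T n) m 0)"
      by (rule upcrosses_measurable) (auto simp: grid_def intro!: real_submartingale_measurable[OF F Z])
    then show ?thesis unfolding E_def by measurable
  qed
  have bnd: "(b - a) * (real m * measure M (E (grid T n))) \<le> ?K" for n
  proof -
    define \<tau> where "\<tau> k = real k / fact n" for k :: nat
    let ?N = "T * fact n"
    let ?U = "\<lambda>\<omega>. real (upcrossings a b (\<lambda>k. Z (\<tau> k) \<omega>) ?N)"
    have \<tau>: "mono \<tau>" "0 \<le> \<tau> 0" by (auto simp: \<tau>_def mono_def divide_right_mono)
    note D = Doob_upcrossing_inequality[OF assms(1) F Z \<tau> assms(4), of ?N]
    have ends: "\<tau> ?N = T" "\<tau> 0 = 0" by (auto simp: \<tau>_def)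
    have "real m * measure M (E (grid T n)) = (\<integral>\<omega>. real m * indicator (E (grid T n)) \<omega> \<partial>M)"
      using E_meas by simp
    also have "\<dots> \<le> (\<integral>\<omega>. ?U \<omega> \<partial>M)"
    proof (rule integral_mono)
      show "integrable M (\<lambda>\<omega>. real m * indicator (E (grid T n)) \<omega>)"
        using E_meas by (intro integrable_mult_right) (auto simp: integrable_indicator_iff less_top[symmetric])
      fix \<omega> assume "\<omega> \<in> space M"
      have "m \<le> upcrossings a b (\<lambda>k. Z (\<tau> k) \<omega>) ?N" if "\<omega> \<in> E (grid T n)"
        using upcrosses_grid_le_upcrossings[OF assms(4), of "\<lambda>q. Z q \<omega>" T n m 0 0] that
        by (simp add: E_def \<tau>_def)
      then show "real m * indicator (E (grid T n)) \<omega> \<le> ?U \<omega>" by (auto simp: indicator_def)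
    qed (rule D(2))
    finally have "(b - a) * (real m * measure M (E (grid T n))) \<le> (b - a) * (\<integral>\<omega>. ?U \<omega> \<partial>M)"
      using assms(4) by (intro mult_left_mono) auto
    with D(1) show ?thesis by (simp only: ends)
  qed
  have inc: "incseq (\<lambda>n. E (grid T n))"
    using incseq_grid[of T] upcrosses_mono by (fastforce simp: incseq_def E_def)
  have UN: "(\<Union>n. E (grid T n)) = E (\<rat> \<inter> {0..real T})"
  proof
    show "(\<Union>n. E (grid T n)) \<subseteq> E (\<rat> \<inter> {0..real T})"
      using UN_grid[of T] upcrosses_mono[of _ a b "grid T _" m 0 "\<rat> \<inter> {0..real T}"]
      by (fastforce simp: E_def)
    show "E (\<rat> \<inter> {0..real T}) \<subseteq> (\<Union>n. E (grid T n))"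
      using upcrosses_UN[OF incseq_grid[of T], of _ a b m 0] unfolding UN_grid by (auto simp: E_def)
  qed
  have "(\<lambda>n. measure M (E (grid T n))) \<longlonglongrightarrow> measure M (E (\<rat> \<inter> {0..real T}))"
    using finite_Lim_measure_incseq[OF _ inc] E_meas unfolding UN by auto
  then have "(\<lambda>n. (b - a) * (real m * measure M (E (grid T n)))) \<longlonglongrightarrow>
      (b - a) * (real m * measure M (E (\<rat> \<inter> {0..real T})))"
    by (intro tendsto_mult tendsto_const)
  then have "(b - a) * (real m * measure M (E (\<rat> \<inter> {0..real T}))) \<le> ?K"
    using bnd by (intro LIMSEQ_le_const2) auto
  then show ?thesis by (simp only: E_def)
qed

text \<open>The intersection of all the events lies in each of them, so m times its measure stays
  below K for every m.\<close>

lemma AE_not_all_if_measure_le: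
  assumes "finite_measure M" "\<And>m. Measurable.pred M (P m)"
    and le: "\<And>m::nat. real m * measure M {\<omega>\<in>space M. P m \<omega>} \<le> K"
  shows "AE \<omega> in M. \<exists>m. \<not> P m \<omega>"
proof -
  interpret finite_measure M by fact
  note assms(2)[measurable]
  let ?A = "{\<omega>\<in>space M. \<forall>m. P m \<omega>}"
  have "measure M ?A \<le> 0"
  proof (rule ccontr)
    assume "\<not> ?thesis"
    then have pos: "0 < measure M ?A" by simp
    obtain m :: nat where "K < real m * measure M ?A" using reals_Archimedean3[OF pos] by blast
    also have "\<dots> \<le> real m * measure M {\<omega>\<in>space M. P m \<omega>}"
      by (intro mult_left_mono finite_measure_mono) auto
    also have "\<dots> \<le> K" by (rule le)
    finally show False by simp
  qed
  then have "emeasure M ?A = 0" by (simp add: emeasure_eq_measure measure_le_0_iff)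
  moreover have "{\<omega>\<in>space M. \<not> (\<exists>m. \<not> P m \<omega>)} = ?A" by auto
  ultimately show ?thesis by (subst AE_iff_measurable[where N="?A"]) auto
qed

lemma AE_finite_upcrossings:
  assumes "prob_space M" and F: "filtration_nonneg M F" and Z: "real_submartingale M F Z" and "a < b"
  shows "AE \<omega> in M. \<exists>m. \<not> upcrosses (\<lambda>q. Z q \<omega>) a b (\<rat> \<inter> {0..real T}) m 0"
proof (rule AE_not_all_if_measure_le)
  interpret prob_space M by fact
  show "finite_measure M" by unfold_locales
  let ?K = "(\<integral>\<omega>. Z T \<omega> \<partial>M) - (\<integral>\<omega>. Z 0 \<omega> \<partial>M) + (\<integral>\<omega>. max 0 (a - Z T \<omega>) \<partial>M)"
  show "real m * measure M {\<omega>\<in>space M. upcrosses (\<lambda>q. Z q \<omega>) a b (\<rat> \<inter> {0..real T}) m 0} \<le> ?K / (b - a)" for m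
    using prob_upcrosses_le[OF assms, of m T] assms(4) by (simp add: pos_le_divide_eq mult.commute)
  show "Measurable.pred M (\<lambda>\<omega>. upcrosses (\<lambda>q. Z q \<omega>) a b (\<rat> \<inter> {0..real T}) m 0)" for m
    by (rule upcrosses_measurable)
       (auto intro!: real_submartingale_measurable[OF F Z] simp: countable_rat countable_Int1)
qed

text \<open>A path that starts below \<open>a\<close> and is unbounded above upcrosses \<open>(a, b)\<close> for every \<open>b\<close>, which by
  the upcrossing inequality has probability \<open>O(1 / (b - a))\<close>.\<close>

lemma AE_bounded_above:
  assumes "prob_space M" and F: "filtration_nonneg M F" and Z: "real_submartingale M F Z"
  shows "AE \<omega> in M. \<exists>B. \<forall>q\<in>\<rat> \<inter> {0..real T}. Z q \<omega> \<le> B"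
proof -
  interpret prob_space M by fact
  have "AE \<omega> in M. \<forall>a::nat. \<exists>m::nat. \<not> upcrosses (\<lambda>q. Z q \<omega>) a (a + real (Suc m)) (\<rat> \<inter> {0..real T}) 1 0"
    unfolding AE_all_countable
  proof (intro allI AE_not_all_if_measure_le)
    show "finite_measure M" by unfold_locales
    fix a m :: nat
    let ?K = "(\<integral>\<omega>. Z T \<omega> \<partial>M) - (\<integral>\<omega>. Z 0 \<omega> \<partial>M) + (\<integral>\<omega>. max 0 (real a - Z T \<omega>) \<partial>M)"
    let ?E = "{\<omega>\<in>space M. upcrosses (\<lambda>q. Z q \<omega>) a (a + real (Suc m)) (\<rat> \<inter> {0..real T}) 1 0}"
    \<comment> \<open>The gap Suc m between the thresholds takes the role of the factor m, while the
      number of crossings stays 1. The successor keeps the gap positive for m = 0, and ?K does not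
      depend on m.\<close>
    have "real m * measure M ?E \<le> real (Suc m) * measure M ?E" by (intro mult_right_mono) auto
    also have "\<dots> \<le> ?K"
      using prob_upcrosses_le[OF assms, of a "a + real (Suc m)" 1 T] by simp
    finally show "real m * measure M ?E \<le> ?K" .
    show "Measurable.pred M (\<lambda>\<omega>. upcrosses (\<lambda>q. Z q \<omega>) a (a + real (Suc m)) (\<rat> \<inter> {0..real T}) 1 0)"
      by (rule upcrosses_measurable)
         (auto intro!: real_submartingale_measurable[OF F Z] simp: countable_rat countable_Int1)
  qed
  then show ?thesis
  proof eventually_elim
    case (elim \<omega>)
    obtain a :: nat where a: "Z 0 \<omega> < a" using reals_Archimedean2 by blast
    obtain m :: nat where m: "\<not> upcrosses (\<lambda>q. Z q \<omega>) a (a + real (Suc m)) (\<rat> \<inter> {0..real T}) 1 0"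
      using elim by blast
    have "Z q \<omega> \<le> a + real (Suc m)" if q: "q \<in> \<rat> \<inter> {0..real T}" for q
    proof (rule ccontr)
      assume *: "\<not> ?thesis"
      then have "q \<noteq> 0" using a by auto
      then have "0 < q" using q by auto
      have "upcrosses (\<lambda>q. Z q \<omega>) a (a + real (Suc m)) (\<rat> \<inter> {0..real T}) (Suc 0) 0"
        unfolding upcrosses.simps using q a * \<open>0 < q\<close> by (intro bexI[of _ 0] bexI[of _ q]) auto
      then show False using m by simp
    qed
    then show ?case by blast
  qed
qed

section \<open>Integrable functions in the L1 closure of the strict past\<close>

definition L1_approximable :: "'w measure \<Rightarrow> (real \<Rightarrow> 'w measure) \<Rightarrow> real \<Rightarrow> ('w \<Rightarrow> real) \<Rightarrow> bool" where
  "L1_approximable M F t f \<longleftrightarrow> integrable M f \<and>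
     (\<forall>\<epsilon>>0. \<exists>r\<in>{0..<t}. \<exists>g\<in>borel_measurable (F r). integrable M g \<and> (\<integral>\<omega>. \<bar>f \<omega> - g \<omega>\<bar> \<partial>M) < \<epsilon>)"

lemma L1_approximable_adapted:
  assumes "integrable M f" "f \<in> borel_measurable (F r)" "r \<in> {0..<t}"
  shows "L1_approximable M F t f"
  using assms unfolding L1_approximable_def by (auto intro!: bexI[of _ r] bexI[of _ f])

lemma L1_approximable_cmult:
  assumes "L1_approximable M F t f"
  shows "L1_approximable M F t (\<lambda>\<omega>. c * f \<omega>)"
  unfolding L1_approximable_def
proof (intro conjI allI impI)
  show "integrable M (\<lambda>\<omega>. c * f \<omega>)" using assms by (auto simp: L1_approximable_def)
  fix \<epsilon> :: real assume "0 < \<epsilon>"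
  \<comment> \<open>The summand 1 keeps the divisor positive when c = 0.\<close>
  then have "0 < \<epsilon> / (\<bar>c\<bar> + 1)" by simp
  then obtain r g where g: "r \<in> {0..<t}" "g \<in> borel_measurable (F r)" "integrable M g"
      "(\<integral>\<omega>. \<bar>f \<omega> - g \<omega>\<bar> \<partial>M) < \<epsilon> / (\<bar>c\<bar> + 1)"
    using assms unfolding L1_approximable_def by blast
  have "(\<integral>\<omega>. \<bar>c * f \<omega> - c * g \<omega>\<bar> \<partial>M) = \<bar>c\<bar> * (\<integral>\<omega>. \<bar>f \<omega> - g \<omega>\<bar> \<partial>M)"
    by (simp flip: right_diff_distrib add: abs_mult)
  also have "\<dots> \<le> (\<bar>c\<bar> + 1) * (\<integral>\<omega>. \<bar>f \<omega> - g \<omega>\<bar> \<partial>M)" by (intro mult_right_mono) auto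
  also have "\<dots> < \<epsilon>" using g(4) by (simp add: pos_less_divide_eq mult.commute)
  finally show "\<exists>r\<in>{0..<t}. \<exists>g\<in>borel_measurable (F r). integrable M g \<and> (\<integral>\<omega>. \<bar>c * f \<omega> - g \<omega>\<bar> \<partial>M) < \<epsilon>"
    using g by (intro bexI[of _ r] bexI[of _ "\<lambda>\<omega>. c * g \<omega>"]) auto
qed

lemma L1_approximable_add:
  assumes F: "filtration_nonneg M F" and "L1_approximable M F t f" "L1_approximable M F t f'"
  shows "L1_approximable M F t (\<lambda>\<omega>. f \<omega> + f' \<omega>)"
  unfolding L1_approximable_def
proof (intro conjI allI impI)
  have int: "integrable M f" "integrable M f'" using assms by (auto simp: L1_approximable_def)
  then show "integrable M (\<lambda>\<omega>. f \<omega> + f' \<omega>)" by simp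
  fix \<epsilon> :: real assume "0 < \<epsilon>"
  then have e: "0 < \<epsilon> / 2" by simp
  from e obtain r g where g: "r \<in> {0..<t}" "g \<in> borel_measurable (F r)" "integrable M g"
      "(\<integral>\<omega>. \<bar>f \<omega> - g \<omega>\<bar> \<partial>M) < \<epsilon> / 2"
    using assms(2) unfolding L1_approximable_def by blast
  from e obtain r' g' where g': "r' \<in> {0..<t}" "g' \<in> borel_measurable (F r')" "integrable M g'"
      "(\<integral>\<omega>. \<bar>f' \<omega> - g' \<omega>\<bar> \<partial>M) < \<epsilon> / 2"
    using assms(3) unfolding L1_approximable_def by blast
  let ?r = "max r r'"
  have [measurable]: "g \<in> borel_measurable (F ?r)" "g' \<in> borel_measurable (F ?r)"
    using measurable_from_subalg[OF filtration_subalgebra_mono[OF F, of r ?r] g(2)]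
      measurable_from_subalg[OF filtration_subalgebra_mono[OF F, of r' ?r] g'(2)] g(1) g'(1) by auto
  have "(\<integral>\<omega>. \<bar>f \<omega> + f' \<omega> - (g \<omega> + g' \<omega>)\<bar> \<partial>M) \<le> (\<integral>\<omega>. \<bar>f \<omega> - g \<omega>\<bar> + \<bar>f' \<omega> - g' \<omega>\<bar> \<partial>M)"
    using int g g' by (intro integral_mono) auto
  also have "\<dots> < \<epsilon>" using int g g' by simp
  finally show "\<exists>r\<in>{0..<t}. \<exists>g\<in>borel_measurable (F r). integrable M g \<and>
      (\<integral>\<omega>. \<bar>f \<omega> + f' \<omega> - g \<omega>\<bar> \<partial>M) < \<epsilon>"
    using g g' by (intro bexI[of _ ?r] bexI[of _ "\<lambda>\<omega>. g \<omega> + g' \<omega>"]) auto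
qed

lemma L1_approximable_sum:
  assumes "filtration_nonneg M F" "0 < t" "\<And>i. i < n \<Longrightarrow> L1_approximable M F t (f i)"
  shows "L1_approximable M F t (\<lambda>\<omega>. \<Sum>i<(n::nat). f i \<omega>)"
  using assms(3)
proof (induction n)
  case 0
  show ?case using assms(2) by (intro L1_approximable_adapted[where r=0]) auto
next
  case (Suc n)
  then show ?case by (simp add: L1_approximable_add[OF assms(1)])
qed

lemma L1_approximable_limit:
  assumes int: "integrable M f" and s: "\<And>i. L1_approximable M F t (s i)"
    and lim: "(\<lambda>i. \<integral>\<omega>. \<bar>f \<omega> - s i \<omega>\<bar> \<partial>M) \<longlonglongrightarrow> 0"
  shows "L1_approximable M F t f"
  unfolding L1_approximable_def
proof (intro conjI allI impI int)
  fix \<epsilon> :: real assume "0 < \<epsilon>"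
  then have e: "0 < \<epsilon> / 2" by simp
  then obtain i where i: "(\<integral>\<omega>. \<bar>f \<omega> - s i \<omega>\<bar> \<partial>M) < \<epsilon> / 2"
    using order_tendstoD(2)[OF lim e] by (auto simp: eventually_sequentially)
  from e obtain r g where g: "r \<in> {0..<t}" "g \<in> borel_measurable (F r)" "integrable M g"
      "(\<integral>\<omega>. \<bar>s i \<omega> - g \<omega>\<bar> \<partial>M) < \<epsilon> / 2"
    using s[of i] unfolding L1_approximable_def by blast
  have si: "integrable M (s i)" using s by (auto simp: L1_approximable_def)
  have "(\<integral>\<omega>. \<bar>f \<omega> - g \<omega>\<bar> \<partial>M) \<le> (\<integral>\<omega>. \<bar>f \<omega> - s i \<omega>\<bar> + \<bar>s i \<omega> - g \<omega>\<bar> \<partial>M)"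
    using int si g by (intro integral_mono) auto
  also have "\<dots> < \<epsilon>" using int si g i by simp
  finally show "\<exists>r\<in>{0..<t}. \<exists>g\<in>borel_measurable (F r). integrable M g \<and> (\<integral>\<omega>. \<bar>f \<omega> - g \<omega>\<bar> \<partial>M) < \<epsilon>"
    using g by blast
qed

lemma L1_approximable_dominated:
  assumes s: "\<And>i. L1_approximable M F t (s i)" and int: "integrable M f" "integrable M w"
    and lim: "\<And>\<omega>. \<omega> \<in> space M \<Longrightarrow> (\<lambda>i. s i \<omega>) \<longlonglongrightarrow> f \<omega>"
    and dom: "\<And>i \<omega>. \<omega> \<in> space M \<Longrightarrow> \<bar>s i \<omega>\<bar> \<le> w \<omega>"
  shows "L1_approximable M F t f"
proof (rule L1_approximable_limit[OF int(1) s])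
  have si: "integrable M (s i)" for i using s by (auto simp: L1_approximable_def)
  have "(\<lambda>i. \<integral>\<omega>. \<bar>f \<omega> - s i \<omega>\<bar> \<partial>M) \<longlonglongrightarrow> (\<integral>\<omega>. 0 \<partial>M)"
  proof (rule integral_dominated_convergence[where w="\<lambda>\<omega>. \<bar>f \<omega>\<bar> + w \<omega>"])
    show "AE \<omega> in M. (\<lambda>i. \<bar>f \<omega> - s i \<omega>\<bar>) \<longlonglongrightarrow> 0"
    proof (rule AE_I2)
      fix \<omega> assume "\<omega> \<in> space M"
      from tendsto_diff[OF tendsto_const lim[OF this], of "f \<omega>"]
      show "(\<lambda>i. \<bar>f \<omega> - s i \<omega>\<bar>) \<longlonglongrightarrow> 0" by (intro tendsto_rabs_zero) simp
    qed
    show "AE \<omega> in M. norm \<bar>f \<omega> - s i \<omega>\<bar> \<le> \<bar>f \<omega>\<bar> + w \<omega>" for i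
      using dom[of _ i] by (intro AE_I2) (smt (verit) real_norm_def)
  qed (use int si in auto)
  then show "(\<lambda>i. \<integral>\<omega>. \<bar>f \<omega> - s i \<omega>\<bar> \<partial>M) \<longlonglongrightarrow> 0" by simp
qed

text \<open>Left continuity says that the union of the earlier sigma-algebras generates
  \<open>F t\<close>, and this union is closed under intersections because they are nested. The
  approximable indicators form a Dynkin system containing it, so all indicators from
  \<open>F t\<close> are approximable; linearity and dominated convergence extend this to integrable
  functions.\<close>

lemma L1_approximable_if_left_continuous_filtration:
  assumes "prob_space M" and F: "filtration_nonneg M F" and "left_continuous_filtration M F" and "0 < t"
    and f: "f \<in> borel_measurable (F t)" "integrable M f"
  shows "L1_approximable M F t f"
proof -
  interpret prob_space M by fact
  have sub: "subalgebra M (F r)" if "0 \<le> r" for r using F that by (auto simp: filtration_nonneg_def)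
  have sp: "space (F r) = space M" if "0 \<le> r" for r using sub[OF that] by (auto simp: subalgebra_def)
  have sets: "sets (F r) \<subseteq> sets M" if "0 \<le> r" for r using sub[OF that] by (auto simp: subalgebra_def)
  have int_ind: "integrable M (indicator A :: _ \<Rightarrow> real)" if "A \<in> sets M" for A
    using that by (intro integrable_real_indicator) (auto simp: less_top[symmetric])
  define G where "G = (\<Union>r\<in>{0..<t}. sets (F r))"
  have Ft: "sets (F t) = sigma_sets (space M) G"
    using assms(3,4) by (auto simp: left_continuous_filtration_def G_def)
  have ind: "L1_approximable M F t (indicator A)" if "A \<in> sets (F t)" for A
  proof -
    have A: "A \<in> sigma_sets (space M) G" using that Ft by simp
    have G: "G \<subseteq> Pow (space M)" using sets.space_closed[of "F _"] sp by (fastforce simp: G_def)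
    have "Int_stable G"
    proof (rule Int_stableI)
      fix A B assume "A \<in> G" "B \<in> G"
      then obtain r r' where r: "r \<in> {0..<t}" "r' \<in> {0..<t}" "A \<in> sets (F r)" "B \<in> sets (F r')"
        by (auto simp: G_def)
      then have "A \<in> sets (F (max r r'))" "B \<in> sets (F (max r r'))"
        using filtration_subalgebra_mono[OF F, of r "max r r'"]
          filtration_subalgebra_mono[OF F, of r' "max r r'"] by (auto simp: subalgebra_def)
      then show "A \<inter> B \<in> G" using r unfolding G_def by (intro UN_I[of "max r r'"]) auto
    qed
    from this G A show ?thesis
    proof (induction rule: sigma_sets_induct_disjoint)
      case (basic A)
      then obtain r where r: "r \<in> {0..<t}" "A \<in> sets (F r)" by (auto simp: G_def)
      then have "A \<in> sets M" using sets by auto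
      with r show ?case by (intro L1_approximable_adapted[where r=r] int_ind) auto
    next
      case empty
      show ?case using assms(4) by (intro L1_approximable_adapted[where r=0] int_ind) auto
    next
      case (compl A)
      have "L1_approximable M F t (\<lambda>\<omega>. indicator (space M) \<omega> + (- 1) * indicator A \<omega>)"
      proof (intro L1_approximable_add[OF F] L1_approximable_cmult compl(2))
        have "space M \<in> sets (F 0)" using sets.top[of "F 0"] sp[of 0] by simp
        then show "L1_approximable M F t (indicator (space M))"
          using assms(4) by (intro L1_approximable_adapted[where r=0] int_ind borel_measurable_indicator) auto
      qed
      moreover have "A \<subseteq> space M" using sigma_sets_into_sp[OF G compl(1)] .
      then have "(\<lambda>\<omega>. indicator (space M) \<omega> + (- 1) * indicator A \<omega>) = (indicator (space M - A) :: _ \<Rightarrow> real)"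
        by (auto simp: indicator_def fun_eq_iff)
      ultimately show ?case by simp
    next
      case (union A)
      have AM: "A i \<in> sets M" for i using union(2) sets[of t] assms(4) by (auto simp: Ft)
      show ?case
      proof (rule L1_approximable_dominated[where s="\<lambda>n \<omega>. \<Sum>i<n. indicator (A i) \<omega>" and w="\<lambda>_. 1"])
        show "L1_approximable M F t (\<lambda>\<omega>. \<Sum>i<n. indicator (A i) \<omega>)" for n
          using union(3) by (intro L1_approximable_sum[OF F assms(4)]) auto
        have sum: "(\<Sum>i<n. indicator (A i) \<omega>) = (indicator (\<Union>i<n. A i) \<omega> :: real)" for n \<omega>
          using union(1) by (intro indicator_UN_disjoint[symmetric]) (auto simp: disjoint_family_on_def)
        show "(\<lambda>n. \<Sum>i<n. indicator (A i) \<omega>) \<longlonglongrightarrow> (indicator (\<Union>i. A i) \<omega> :: real)" for \<omega>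
          unfolding sum by (rule LIMSEQ_indicator_UN)
        show "\<bar>\<Sum>i<n. indicator (A i) \<omega>\<bar> \<le> (1::real)" for n \<omega>
          unfolding sum by (simp add: indicator_def)
      qed (use AM in \<open>auto simp: less_top[symmetric]\<close>)
    qed
  qed
  \<comment> \<open>Working in the restriction of \<open>M\<close> to \<open>F t\<close> makes the
    induction for integrable functions start from indicators of sets in \<open>F t\<close> only. Its
    limit case supplies the bound 2 |f| used for domination.\<close>
  let ?R = "restr_to_subalg M (F t)"
  have subt: "subalgebra M (F t)" using sub assms(4) by simp
  have R: "sets ?R = sets (F t)" "space ?R = space M"
    using sets_restr_to_subalg[OF subt] by (auto simp: space_restr_to_subalg)
  have "integrable ?R f" by (rule integrable_in_subalg[OF subt f])
  then show ?thesis
  proof (induction rule: integrable_induct)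
    case (base A c)
    then show ?case using L1_approximable_cmult[OF ind, of A c] by (simp add: R mult.commute)
  next
    case (add f g)
    then show ?case by (intro L1_approximable_add[OF F])
  next
    case (lim f s)
    show ?case
      by (rule L1_approximable_dominated[where s=s and w="\<lambda>\<omega>. 2 * \<bar>f \<omega>\<bar>"])
         (use lim integrable_from_subalg[OF subt \<open>integrable ?R f\<close>] in \<open>auto simp: R\<close>)
  qed
qed

text \<open>If \<open>g\<close> is \<open>F r\<^sub>0\<close>-measurable and close to \<open>Z t\<close> in \<open>L\<^sup>1\<close>, then for \<open>r\<^sub>0 \<le> r < t\<close> the
  submartingale inequality on \<open>{Z r > g}\<close> bounds the positive part of \<open>Z r - g\<close>, and the
  expectations bound the negative part.\<close>

lemma real_submartingale_L1_left_continuous: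
  assumes "prob_space M" and F: "filtration_nonneg M F" and "left_continuous_filtration M F"
    and Z: "real_submartingale M F Z" and "0 < t"
    and exp: "((\<lambda>r. \<integral>\<omega>. Z r \<omega> \<partial>M) \<longlongrightarrow> (\<integral>\<omega>. Z t \<omega> \<partial>M)) (at_left t)"
  shows "((\<lambda>r. \<integral>\<omega>. \<bar>Z r \<omega> - Z t \<omega>\<bar> \<partial>M) \<longlongrightarrow> 0) (at_left t)"
proof (rule tendstoI)
  interpret prob_space M by fact
  fix e :: real assume "0 < e"
  define \<epsilon> where "\<epsilon> = e / 5"
  have \<epsilon>: "0 < \<epsilon>" using \<open>0 < e\<close> by (simp add: \<epsilon>_def)
  note int = real_submartingale_integrable[OF F Z]
  have "L1_approximable M F t (Z t)"
    using Z \<open>0 < t\<close> by (intro L1_approximable_if_left_continuous_filtration assms)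
      (auto simp: real_submartingale_def)
  then obtain r0 g where g: "0 \<le> r0" "r0 < t" "g \<in> borel_measurable (F r0)" "integrable M g"
      "(\<integral>\<omega>. \<bar>Z t \<omega> - g \<omega>\<bar> \<partial>M) < \<epsilon>"
    using \<epsilon> unfolding L1_approximable_def by (metis atLeastLessThan_iff)
  have "\<forall>\<^sub>F r in at_left t. r0 < r"
    by (rule order_tendstoD(1)[OF tendsto_ident_at g(2)])
  moreover have "\<forall>\<^sub>F r in at_left t. r < t" by (simp add: eventually_at_filter)
  moreover have "\<forall>\<^sub>F r in at_left t. dist (\<integral>\<omega>. Z r \<omega> \<partial>M) (\<integral>\<omega>. Z t \<omega> \<partial>M) < \<epsilon>"
    by (rule tendstoD[OF exp \<epsilon>])
  ultimately show "\<forall>\<^sub>F r in at_left t. dist (\<integral>\<omega>. \<bar>Z r \<omega> - Z t \<omega>\<bar> \<partial>M) 0 < e"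
  proof eventually_elim
    case (elim r)
    then have r: "0 \<le> r" "r \<le> t" using g by auto
    have sp: "space (F r) = space M" "sets (F r) \<subseteq> sets M"
      using F r by (auto simp: filtration_nonneg_def subalgebra_def)
    have [measurable]: "g \<in> borel_measurable (F r)" "Z r \<in> borel_measurable (F r)"
      using measurable_from_subalg[OF filtration_subalgebra_mono[OF F g(1), of r] g(3)] elim(1)
        real_submartingale_adapted[OF F Z r(1), of r] by auto
    define A where "A = {\<omega>\<in>space M. g \<omega> < Z r \<omega>}"
    have "{\<omega>\<in>space (F r). g \<omega> < Z r \<omega>} \<in> sets (F r)" by measurable
    then have A: "A \<in> sets (F r)" "A \<in> sets M" using sp by (auto simp: A_def)
    have intA: "integrable M (\<lambda>\<omega>. indicator A \<omega> * h \<omega>)" if "integrable M h" for h :: "_ \<Rightarrow> real"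
      using integrable_real_mult_indicator[OF A(2) that] by (simp add: mult.commute)
    note ints[simp] = int[OF r(1)] int[OF less_imp_le[OF \<open>0 < t\<close>]] g(4)
    \<comment> \<open>The absolute value of h = Z r - g is 2 h on \<open>A\<close> minus h
      everywhere. In this form \<open>Z r\<close> can be replaced by \<open>Z t\<close>: on
      \<open>A\<close> by the submartingale inequality, in the full expectation at the cost
      \<epsilon>.\<close>
    have "(\<integral>\<omega>. \<bar>Z r \<omega> - g \<omega>\<bar> \<partial>M) =
        (\<integral>\<omega>. 2 * (indicator A \<omega> * Z r \<omega>) - 2 * (indicator A \<omega> * g \<omega>) - Z r \<omega> + g \<omega> \<partial>M)"
      by (intro Bochner_Integration.integral_cong) (auto simp: A_def indicator_def)
    also have "\<dots> = 2 * (\<integral>\<omega>. indicator A \<omega> * Z r \<omega> \<partial>M) - 2 * (\<integral>\<omega>. indicator A \<omega> * g \<omega> \<partial>M)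
        - (\<integral>\<omega>. Z r \<omega> \<partial>M) + (\<integral>\<omega>. g \<omega> \<partial>M)"
      using intA by simp
    also have "\<dots> \<le> 2 * (\<integral>\<omega>. indicator A \<omega> * Z t \<omega> \<partial>M) - 2 * (\<integral>\<omega>. indicator A \<omega> * g \<omega> \<partial>M)
        - (\<integral>\<omega>. Z t \<omega> \<partial>M) + \<epsilon> + (\<integral>\<omega>. g \<omega> \<partial>M)"
    proof -
      have "(\<integral>\<omega>. indicator A \<omega> * Z r \<omega> \<partial>M) \<le> (\<integral>\<omega>. indicator A \<omega> * Z t \<omega> \<partial>M)"
        using Z r A by (auto simp: real_submartingale_def)
      then show ?thesis using elim(3) unfolding dist_real_def by linarith
    qed
    also have "\<dots> = (\<integral>\<omega>. 2 * (indicator A \<omega> * Z t \<omega>) - 2 * (indicator A \<omega> * g \<omega>) - Z t \<omega> + g \<omega> \<partial>M) + \<epsilon>"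
      using intA by simp
    \<comment> \<open>The integrand is Z t - g on \<open>A\<close> and its negative off
      \<open>A\<close>; although \<open>A\<close> was chosen for \<open>Z r\<close>, either sign is
      dominated by the absolute value.\<close>
    also have "\<dots> \<le> (\<integral>\<omega>. \<bar>Z t \<omega> - g \<omega>\<bar> \<partial>M) + \<epsilon>"
    proof (intro add_right_mono integral_mono)
      show "integrable M (\<lambda>\<omega>. 2 * (indicator A \<omega> * Z t \<omega>) - 2 * (indicator A \<omega> * g \<omega>) - Z t \<omega> + g \<omega>)"
        using intA[of "Z t"] intA[of g] by simp
    qed (auto simp: indicator_def)
    finally have 1: "(\<integral>\<omega>. \<bar>Z r \<omega> - g \<omega>\<bar> \<partial>M) < 2 * \<epsilon>" using g(5) by simp
    have "(\<integral>\<omega>. \<bar>Z r \<omega> - Z t \<omega>\<bar> \<partial>M) \<le> (\<integral>\<omega>. \<bar>Z r \<omega> - g \<omega>\<bar> + \<bar>Z t \<omega> - g \<omega>\<bar> \<partial>M)"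
      by (intro integral_mono) auto
    also have "\<dots> = (\<integral>\<omega>. \<bar>Z r \<omega> - g \<omega>\<bar> \<partial>M) + (\<integral>\<omega>. \<bar>Z t \<omega> - g \<omega>\<bar> \<partial>M)" by simp
    finally have "(\<integral>\<omega>. \<bar>Z r \<omega> - Z t \<omega>\<bar> \<partial>M) < 3 * \<epsilon>" using 1 g(5) by simp
    then show ?case using \<epsilon> by (simp add: \<epsilon>_def)
  qed
qed

text \<open>L1 convergence gives almost sure convergence only along a subsequence. That is enough to
  identify a limit already known to exist, which is why existence appears as a premise inside the
  almost sure statement.\<close>

lemma AE_left_limit_eq:
  assumes "prob_space M" and F: "filtration_nonneg M F" and "left_continuous_filtration M F"
    and Z: "real_submartingale M F Z" and "0 < t"
    and exp: "((\<lambda>r. \<integral>\<omega>. Z r \<omega> \<partial>M) \<longlongrightarrow> (\<integral>\<omega>. Z t \<omega> \<partial>M)) (at_left t)"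
  shows "AE \<omega> in M. \<forall>l. ((\<lambda>r. Z r \<omega>) \<longlongrightarrow> l) (at t within {r\<in>\<rat>. 0 \<le> r \<and> r < t}) \<longrightarrow> l = Z t \<omega>"
proof -
  have "\<exists>q\<in>\<rat>. max 0 (t - 1 / real (Suc n)) < q \<and> q < t" for n
    using \<open>0 < t\<close> by (intro Rats_dense_in_real) auto
  then obtain q where q: "\<And>n. q n \<in> \<rat>" "\<And>n. max 0 (t - 1 / real (Suc n)) < q n" "\<And>n. q n < t"
    by metis
  have q0: "0 < q n" "t - 1 / real (Suc n) \<le> q n" for n using q(2)[of n] by auto
  have "(\<lambda>n. t - 1 / real (Suc n)) \<longlonglongrightarrow> t - 0"
    by (intro tendsto_diff tendsto_const LIMSEQ_Suc lim_1_over_n)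
  then have "q \<longlonglongrightarrow> t"
    by (intro tendsto_sandwich[of "\<lambda>n. t - 1 / real (Suc n)" q sequentially "\<lambda>_. t" t])
       (use q0 q(3) in \<open>auto intro!: always_eventually less_imp_le\<close>)
  then have q_within: "filterlim q (at t within {r\<in>\<rat>. 0 \<le> r \<and> r < t}) sequentially"
    and q_left: "filterlim q (at_left t) sequentially"
    using q(1) q(3) q0(1) less_imp_neq[OF q(3)] by (auto simp: filterlim_at less_imp_le)
  have "(\<lambda>n. \<integral>\<omega>. \<bar>Z (q n) \<omega> - Z t \<omega>\<bar> \<partial>M) \<longlonglongrightarrow> 0"
    using real_submartingale_L1_left_continuous[OF assms] q_left by (rule filterlim_compose)
  then have "\<exists>s::nat\<Rightarrow>nat. strict_mono s \<and> (AE \<omega> in M. (\<lambda>n. Z (q (s n)) \<omega> - Z t \<omega>) \<longlonglongrightarrow> 0)"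
    using q0(1) \<open>0 < t\<close> real_submartingale_integrable[OF F Z]
    by (intro tendsto_L1_AE_subseq) (auto simp: less_imp_le)
  then obtain s :: "nat \<Rightarrow> nat" where s: "strict_mono s"
    "AE \<omega> in M. (\<lambda>n. Z (q (s n)) \<omega> - Z t \<omega>) \<longlonglongrightarrow> 0" by blast
  from s(2) show ?thesis
  proof eventually_elim
    case (elim \<omega>)
    show ?case
    proof (intro allI impI)
      fix l assume "((\<lambda>r. Z r \<omega>) \<longlongrightarrow> l) (at t within {r\<in>\<rat>. 0 \<le> r \<and> r < t})"
      then have "(\<lambda>n. Z (q n) \<omega>) \<longlonglongrightarrow> l" using q_within by (rule filterlim_compose)
      then have "(\<lambda>n. Z (q (s n)) \<omega>) \<longlonglongrightarrow> l"
        using LIMSEQ_subseq_LIMSEQ[OF _ s(1)] by (simp add: o_def)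
      moreover have "(\<lambda>n. Z (q (s n)) \<omega>) \<longlonglongrightarrow> Z t \<omega>" using elim by (simp add: LIM_zero_iff)
      ultimately show "l = Z t \<omega>" by (rule LIMSEQ_unique)
    qed
  qed
qed

section \<open>Support functions and Hausdorff limits\<close>

text \<open>A real-valued version that can serve as an integrand. Where \<open>support_fun\<close>
  is infinite it takes the value 0, so it is faithful for bounded nonempty sets, and the lemmas
  about it ask for boundedness.\<close>

definition real_support :: "'a::euclidean_space \<Rightarrow> 'a set \<Rightarrow> real" where
  "real_support x C = real_of_ereal (support_fun x C)"

lemma support_fun_eq_ereal:
  assumes "bounded C" "C \<noteq> {}"
  shows "support_fun x C = ereal (real_support x C)"
proof -
  obtain B where B: "\<And>y. y \<in> C \<Longrightarrow> norm y \<le> B" using assms(1) bounded_iff by blast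
  have "x \<bullet> y \<le> norm x * B" if "y \<in> C" for y
    using norm_cauchy_schwarz[of x y] B[OF that] by (meson mult_left_mono norm_ge_zero order_trans)
  then have "support_fun x C \<le> ereal (norm x * B)"
    unfolding support_fun_def by (intro SUP_least) simp
  moreover obtain y where "y \<in> C" using assms(2) by blast
  then have "ereal (x \<bullet> y) \<le> support_fun x C" unfolding support_fun_def by (rule SUP_upper)
  ultimately have "\<bar>support_fun x C\<bar> \<noteq> \<infinity>" by (cases "support_fun x C") auto
  then show ?thesis by (simp add: real_support_def ereal_real)
qed

lemma real_support_upper:
  assumes "bounded C" "y \<in> C"
  shows "x \<bullet> y \<le> real_support x C"
proof -
  have "ereal (x \<bullet> y) \<le> support_fun x C"
    unfolding support_fun_def using assms(2) by (rule SUP_upper)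
  also have "\<dots> = ereal (real_support x C)" using support_fun_eq_ereal assms by blast
  finally show ?thesis by simp
qed

lemma real_support_least:
  assumes "bounded C" "C \<noteq> {}" "\<And>y. y \<in> C \<Longrightarrow> x \<bullet> y \<le> B"
  shows "real_support x C \<le> B"
proof -
  have "ereal (real_support x C) = support_fun x C" using support_fun_eq_ereal assms by metis
  also have "\<dots> \<le> ereal B" unfolding support_fun_def by (rule SUP_least) (simp add: assms)
  finally show ?thesis by simp
qed

lemma real_support_diff_le:
  assumes "C \<subseteq> cball 0 R" "C \<noteq> {}"
  shows "real_support x C \<le> real_support x' C + norm (x - x') * R"
proof (rule real_support_least)
  show b: "bounded C" using assms(1) bounded_cball bounded_subset by blast
  fix y assume y: "y \<in> C"
  have "x \<bullet> y = x' \<bullet> y + (x - x') \<bullet> y" by (simp add: inner_diff_left)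
  also have "(x - x') \<bullet> y \<le> norm (x - x') * norm y" by (rule norm_cauchy_schwarz)
  also have "\<dots> \<le> norm (x - x') * R" using y assms(1) by (intro mult_left_mono) auto
  finally show "x \<bullet> y \<le> real_support x' C + norm (x - x') * R"
    using real_support_upper[OF b y, of x'] by simp
qed fact

lemma abs_real_support_le:
  assumes "C \<subseteq> cball 0 R" "C \<noteq> {}"
  shows "\<bar>real_support x C\<bar> \<le> norm x * R"
proof -
  have b: "bounded C" using assms(1) bounded_cball bounded_subset by blast
  have "real_support 0 C = 0"
    using real_support_upper[OF b, of _ 0] real_support_least[OF b assms(2), of 0 0] assms(2)
    by (auto intro: antisym)
  then show ?thesis
    using real_support_diff_le[OF assms, of x 0] real_support_diff_le[OF assms, of 0 x] by auto
qed

text \<open>Separation by the nearest point: with p the projection of y onto \<open>D\<close> and u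
  the unit vector from p towards y, convexity makes p maximise the inner product with u over
  \<open>D\<close>. Hence |y - p| equals u \<bullet> y - u \<bullet> p, which is at most the
  difference of the support functions at u.\<close>

lemma infdist_le_if_real_support_le:
  assumes D: "closed D" "convex D" "D \<noteq> {}" "bounded D" and C: "bounded C" "y \<in> C" and "0 \<le> \<eta>"
    and le: "\<And>u. norm u \<le> 1 \<Longrightarrow> real_support u C \<le> real_support u D + \<eta>"
  shows "infdist y D \<le> \<eta>"
proof (cases "y \<in> D")
  case True
  then show ?thesis using \<open>0 \<le> \<eta>\<close> by simp
next
  case False
  define p where "p = closest_point D y"
  define u where "u = (y - p) /\<^sub>R norm (y - p)"
  have p: "p \<in> D" unfolding p_def by (rule closest_point_in_set[OF D(1,3)])
  then have ne: "norm (y - p) > 0" using False by auto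
  have "u \<bullet> z \<le> u \<bullet> p" if "z \<in> D" for z
  proof -
    have "(y - p) \<bullet> (z - p) \<le> 0" using closest_point_dot[OF D(2,1) that, of y] by (simp add: p_def)
    then have "u \<bullet> (z - p) \<le> 0" by (simp add: u_def mult_nonneg_nonpos)
    then show ?thesis by (simp add: inner_diff_right)
  qed
  then have "real_support u D \<le> u \<bullet> p" by (intro real_support_least D)
  moreover have "norm u \<le> 1" using ne by (simp add: u_def)
  ultimately have "u \<bullet> y \<le> u \<bullet> p + \<eta>" using le[of u] real_support_upper[OF C, of u] by linarith
  moreover have "u \<bullet> y - u \<bullet> p = norm (y - p)"
  proof -
    have "u \<bullet> y - u \<bullet> p = inverse (norm (y - p)) * ((y - p) \<bullet> (y - p))"
      by (simp add: u_def right_diff_distrib inner_diff_right)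
    also have "\<dots> = norm (y - p)"
      using ne by (subst power2_norm_eq_inner[symmetric]) (simp add: power2_eq_square)
    finally show ?thesis .
  qed
  moreover have "infdist y D \<le> dist y p" by (rule infdist_le[OF p])
  ultimately show ?thesis by (simp add: dist_norm)
qed

lemma dist_closest_point_eq_infdist:
  "closed S \<Longrightarrow> S \<noteq> {} \<Longrightarrow> dist y (closest_point S y) = infdist y S"
  unfolding infdist_eq_setdist by (rule setdist_closest_point[symmetric])

text \<open>Compactness of the unit ball provides a finite net inside the dense set. Finiteness
  turns convergence in each direction separately into simultaneous convergence on the net.\<close>

lemma finite_net_of_dense:
  fixes W :: "'a::euclidean_space set"
  assumes "cball 0 1 \<subseteq> closure W" "0 < \<epsilon>"
  obtains K where "finite K" "K \<subseteq> W" "cball 0 1 \<subseteq> (\<Union>x\<in>K. ball x \<epsilon>)"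
proof -
  have "cball 0 1 \<subseteq> (\<Union>x\<in>W. ball x \<epsilon>)"
  proof
    fix u :: 'a assume "u \<in> cball 0 1"
    then obtain x where "x \<in> W" "dist x u < \<epsilon>"
      using assms closure_approachable[of u W] by blast
    then show "u \<in> (\<Union>x\<in>W. ball x \<epsilon>)" by auto
  qed
  then obtain K where "K \<subseteq> W" "finite K" "cball 0 1 \<subseteq> (\<Union>x\<in>K. ball x \<epsilon>)"
    by (rule compactE_image[OF compact_cball, rotated]) auto
  then show thesis using that by blast
qed

text \<open>Support functions of subsets of the ball of radius R are R-Lipschitz in the direction.
  Moving from u to a net point and back costs R \<epsilon> for each of the two sets, whence 2 R
  \<epsilon>.\<close>

lemma infdist_le_if_real_support_close_on_net:
  assumes D: "closed D" "convex D" "D \<noteq> {}" "D \<subseteq> cball 0 R" and C: "C \<subseteq> cball 0 R" "y \<in> C"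
    and K: "cball 0 1 \<subseteq> (\<Union>x\<in>K. ball x \<epsilon>)"
    and le: "\<And>x. x \<in> K \<Longrightarrow> real_support x C \<le> real_support x D + \<delta>"
    and nn: "0 \<le> \<delta>" "0 \<le> \<epsilon>"
  shows "infdist y D \<le> \<delta> + 2 * R * \<epsilon>"
proof (rule infdist_le_if_real_support_le[OF D(1-3) _ _ C(2)])
  have C_ne: "C \<noteq> {}" and "norm y \<le> R" using C by auto
  then have R: "0 \<le> R" using norm_ge_zero[of y] by linarith
  then show "0 \<le> \<delta> + 2 * R * \<epsilon>" using nn by simp
  fix u :: 'a assume "norm u \<le> 1"
  then obtain x where x: "x \<in> K" "norm (x - u) < \<epsilon>" using K by (auto simp: subset_iff dist_norm)
  have "norm (x - u) * R \<le> \<epsilon> * R" using x R by (intro mult_right_mono) auto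
  then show "real_support u C \<le> real_support u D + (\<delta> + 2 * R * \<epsilon>)"
    using real_support_diff_le[OF C(1) C_ne, of u x] real_support_diff_le[OF D(4,3), of x u] le[OF x(1)]
    by (simp add: norm_minus_commute[of u x] algebra_simps)
next
  show "bounded C" "bounded D" using C D bounded_cball bounded_subset by blast+
qed

lemma hausdorff_distance_leI:
  assumes "\<And>x. x \<in> C \<Longrightarrow> infdist x D \<le> \<eta>" "\<And>y. y \<in> D \<Longrightarrow> infdist y C \<le> \<eta>"
  shows "hausdorff_distance C D \<le> ennreal \<eta>"
  unfolding hausdorff_distance_def using assms by (auto intro!: SUP_least ennreal_leI)

lemma infdist_lt_of_hausdorff_distance:
  assumes "hausdorff_distance C D < ennreal \<eta>" "0 < \<eta>"
  shows "x \<in> C \<Longrightarrow> infdist x D < \<eta>" "y \<in> D \<Longrightarrow> infdist y C < \<eta>"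
proof -
  assume "x \<in> C"
  then have "ennreal (infdist x D) \<le> hausdorff_distance C D"
    unfolding hausdorff_distance_def by (meson SUP_upper max.coboundedI1)
  then show "infdist x D < \<eta>" using assms by (meson ennreal_less_iff infdist_nonneg le_less_trans)
next
  assume "y \<in> D"
  then have "ennreal (infdist y C) \<le> hausdorff_distance C D"
    unfolding hausdorff_distance_def by (meson SUP_upper max.coboundedI2)
  then show "infdist y C < \<eta>" using assms by (meson ennreal_less_iff infdist_nonneg le_less_trans)
qed

lemma hausdorff_tendstoI:
  assumes "closed L" "L \<noteq> {}"
    and "\<And>\<eta>. 0 < \<eta> \<Longrightarrow> \<forall>\<^sub>F r in F. (\<forall>y\<in>N r. infdist y L \<le> \<eta>) \<and> (\<forall>y\<in>L. infdist y (N r) \<le> \<eta>)"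
  shows "hausdorff_tendsto N L F"
  unfolding hausdorff_tendsto_def
proof (intro conjI assms(1,2) order_tendstoI)
  fix e :: ennreal assume "0 < e"
  then obtain d where d: "0 < d" "d < e" using dense by blast
  then obtain \<eta> where \<eta>: "d = ennreal \<eta>" "0 < \<eta>"
    by (cases d) (auto simp: ennreal_zero_less_top)
  show "\<forall>\<^sub>F r in F. hausdorff_distance (N r) L < e"
    using assms(3)[OF \<eta>(2)]
  proof eventually_elim
    case (elim r)
    then have "hausdorff_distance (N r) L \<le> ennreal \<eta>" by (intro hausdorff_distance_leI) auto
    then show ?case using d \<eta> by (meson le_less_trans)
  qed
qed simp

lemma hausdorff_tendstoD:
  assumes "hausdorff_tendsto N L F" "0 < \<eta>"
  shows "\<forall>\<^sub>F r in F. (\<forall>y\<in>N r. infdist y L < \<eta>) \<and> (\<forall>y\<in>L. infdist y (N r) < \<eta>)"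
proof -
  have "\<forall>\<^sub>F r in F. hausdorff_distance (N r) L < ennreal \<eta>"
    using assms by (intro order_tendstoD(2)[where y=0]) (auto simp: hausdorff_tendsto_def)
  then show ?thesis
    by eventually_elim (use infdist_lt_of_hausdorff_distance[OF _ assms(2)] in blast)
qed

text \<open>Each limit lies in every neighbourhood of the other, by way of a common
  \<open>N r\<close>. Nonemptiness of \<open>N r\<close> matters because \<open>infdist\<close> to
  the empty set is 0, which puts the empty set at Hausdorff distance 0 from every set.\<close>

lemma hausdorff_tendsto_unique:
  assumes "F \<noteq> bot" "hausdorff_tendsto N L F" "hausdorff_tendsto N K F" "\<forall>\<^sub>F r in F. N r \<noteq> {}"
  shows "L = K"
proof -
  have "A \<subseteq> B" if A: "hausdorff_tendsto N A F" and B: "hausdorff_tendsto N B F" for A B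
  proof
    fix y assume y: "y \<in> A"
    have "infdist y B < \<eta>" if "0 < \<eta>" for \<eta>
    proof -
      have "0 < \<eta> / 2" using that by simp
      have "\<forall>\<^sub>F r in F. infdist y B < \<eta>"
        using hausdorff_tendstoD[OF A \<open>0 < \<eta> / 2\<close>] hausdorff_tendstoD[OF B \<open>0 < \<eta> / 2\<close>] assms(4)
      proof eventually_elim
        case (elim r)
        then have "infdist y (N r) < \<eta> / 2" using y by blast
        then obtain p where p: "p \<in> N r" "dist y p < \<eta> / 2"
          using elim(3) cINF_less_iff[of "N r" "dist y" "\<eta> / 2"] by (auto simp: infdist_notempty intro: bdd_below.I2[of _ 0])
        have "infdist y B \<le> infdist p B + dist y p" by (rule infdist_triangle)
        then show ?case using p elim(2) by fastforce
      qed
      then show ?thesis using assms(1) by simp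
    qed
    then have "infdist y B \<le> 0" using dense_ge[of 0 "infdist y B"] less_imp_le by blast
    then show "y \<in> B" using B infdist_nonneg[of y B]
      by (auto simp: hausdorff_tendsto_def in_closed_iff_infdist_zero)
  qed
  then show ?thesis using assms by blast
qed

lemma hausdorff_tendsto_if_real_support_tendsto:
  fixes N :: "'b \<Rightarrow> 'a::euclidean_space set"
  assumes W: "cball 0 1 \<subseteq> closure W"
    and N: "\<forall>\<^sub>F r in F. closed (N r) \<and> convex (N r) \<and> N r \<noteq> {} \<and> N r \<subseteq> cball 0 R"
    and L: "closed L" "convex L" "L \<noteq> {}" "bounded L"
    and lim: "\<And>x. x \<in> W \<Longrightarrow> ((\<lambda>r. real_support x (N r)) \<longlongrightarrow> real_support x L) F"
  shows "hausdorff_tendsto N L F"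
proof (rule hausdorff_tendstoI[OF L(1,3)])
  fix \<eta> :: real assume "0 < \<eta>"
  obtain B where B: "0 < B" "\<And>y. y \<in> L \<Longrightarrow> norm y \<le> B" using L(4) bounded_pos by blast
  \<comment> \<open>A common radius for \<open>L\<close> and the sets \<open>N r\<close>, positive
    so that it can be divided by. The choice of \<epsilon> makes the net error 2 R' \<epsilon> equal
    to \<eta>/2.\<close>
  define R' where "R' = max \<bar>R\<bar> B"
  have R': "0 < R'" "L \<subseteq> cball 0 R'" "cball 0 R \<subseteq> cball (0::'a) R'"
    using B(1) by (auto simp: R'_def dest!: B(2))
  define \<epsilon> where "\<epsilon> = \<eta> / (4 * R')"
  have \<epsilon>: "0 < \<epsilon>" "\<eta> / 2 + 2 * R' * \<epsilon> = \<eta>" using R' \<open>0 < \<eta>\<close> by (auto simp: \<epsilon>_def field_simps)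
  obtain K where K: "finite K" "K \<subseteq> W" "cball 0 1 \<subseteq> (\<Union>x\<in>K. ball x \<epsilon>)"
    using finite_net_of_dense[OF W \<epsilon>(1)] by blast
  have "\<forall>\<^sub>F r in F. \<forall>x\<in>K. dist (real_support x (N r)) (real_support x L) < \<eta> / 2"
    using K lim \<open>0 < \<eta>\<close> by (intro eventually_ball_finite ballI tendstoD) auto
  with N show "\<forall>\<^sub>F r in F. (\<forall>y\<in>N r. infdist y L \<le> \<eta>) \<and> (\<forall>y\<in>L. infdist y (N r) \<le> \<eta>)"
  proof eventually_elim
    case (elim r)
    have *: "N r \<subseteq> cball 0 R'" using elim R' by blast
    have "infdist y L \<le> \<eta> / 2 + 2 * R' * \<epsilon>" if "y \<in> N r" for y
    proof (rule infdist_le_if_real_support_close_on_net[OF L(1-3) R'(2) * that K(3)])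
      show "real_support x (N r) \<le> real_support x L + \<eta> / 2" if "x \<in> K" for x
        using elim(2)[rule_format, OF that] by (auto simp: dist_real_def abs_if split: if_splits)
    qed (use \<epsilon> \<open>0 < \<eta>\<close> in auto)
    moreover have "infdist y (N r) \<le> \<eta> / 2 + 2 * R' * \<epsilon>" if "y \<in> L" for y
    proof (rule infdist_le_if_real_support_close_on_net[OF _ _ _ * R'(2) that K(3)])
      show "real_support x L \<le> real_support x (N r) + \<eta> / 2" if "x \<in> K" for x
        using elim(2)[rule_format, OF that] by (auto simp: dist_real_def abs_if split: if_splits)
    qed (use elim \<epsilon> \<open>0 < \<eta>\<close> in auto)
    ultimately show ?case using \<epsilon>(2) by simp
  qed
qed

text \<open>Completeness of the Hausdorff metric: the limit consists of the points whose distance to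
  \<open>N r\<close> vanishes, and it is reached from any \<open>y \<in> N r\<close> through a cluster point of the closest
  points to \<open>y\<close>.\<close>

lemma hausdorff_Cauchy_imp_tendsto:
  fixes N :: "'b \<Rightarrow> 'a::euclidean_space set"
  assumes "F \<noteq> bot"
    and N: "\<forall>\<^sub>F r in F. closed (N r) \<and> convex (N r) \<and> N r \<noteq> {} \<and> N r \<subseteq> cball 0 R"
    and Cauchy: "\<And>\<eta>. 0 < \<eta> \<Longrightarrow>
      \<exists>P. eventually P F \<and> (\<forall>r r'. P r \<longrightarrow> P r' \<longrightarrow> (\<forall>y\<in>N r. infdist y (N r') \<le> \<eta>))"
  shows "\<exists>L. convex L \<and> hausdorff_tendsto N L F"
proof -
  define L where "L = {y. ((\<lambda>r. infdist y (N r)) \<longlongrightarrow> 0) F}"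
  have Cauchy': "\<exists>P. eventually P F \<and> (\<forall>r. P r \<longrightarrow> closed (N r) \<and> convex (N r) \<and> N r \<noteq> {} \<and> N r \<subseteq> cball 0 R)
      \<and> (\<forall>r r'. P r \<longrightarrow> P r' \<longrightarrow> (\<forall>y\<in>N r. infdist y (N r') \<le> \<eta>))" if \<eta>: "0 < \<eta>" for \<eta>
  proof -
    obtain P where "eventually P F" "\<forall>r r'. P r \<longrightarrow> P r' \<longrightarrow> (\<forall>y\<in>N r. infdist y (N r') \<le> \<eta>)"
      using Cauchy[OF \<eta>] by blast
    then show ?thesis
      by (intro exI[of _ "\<lambda>r. P r \<and> closed (N r) \<and> convex (N r) \<and> N r \<noteq> {} \<and> N r \<subseteq> cball 0 R"])
         (auto intro: eventually_conj N)
  qed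
  have L_I: "y \<in> L" if "\<And>\<eta>. 0 < \<eta> \<Longrightarrow> \<forall>\<^sub>F r in F. infdist y (N r) \<le> \<eta>" for y
    unfolding L_def mem_Collect_eq tendsto_iff
  proof (intro allI impI)
    fix e :: real assume "0 < e"
    then have "0 < e / 2" by simp
    from that[OF this] show "\<forall>\<^sub>F r in F. dist (infdist y (N r)) 0 < e"
      by eventually_elim (use \<open>0 < e\<close> in \<open>auto simp: infdist_nonneg\<close>)
  qed
  have L_D: "\<forall>\<^sub>F r in F. infdist y (N r) < \<eta>" if "y \<in> L" "0 < \<eta>" for y \<eta>
    using that by (auto simp: L_def intro: order_tendstoD(2))
  have near: "\<exists>z\<in>L. dist y z \<le> \<eta>"
    if P: "eventually P F" "\<And>r. P r \<Longrightarrow> closed (N r) \<and> N r \<noteq> {} \<and> N r \<subseteq> cball 0 R"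
      and *: "\<And>r. P r \<Longrightarrow> infdist y (N r) \<le> \<eta>" for y \<eta> P
  proof -
    define c where "c r = closest_point (N r) y" for r
    have c: "c r \<in> N r" "dist y (c r) \<le> \<eta>" if "P r" for r
      using that P *[OF that] closest_point_in_set[of "N r" y]
        dist_closest_point_eq_infdist[of "N r" y] by (auto simp: c_def)
    have "filtermap c F \<noteq> bot" using assms(1) by (simp add: filtermap_bot_iff)
    moreover have "eventually (\<lambda>z. z \<in> cball 0 R) (filtermap c F)"
      unfolding eventually_filtermap using P(1) by eventually_elim (use c P(2) in blast)
    \<comment> \<open>Compactness in its filter form, since the index filter is arbitrary: z is a
      cluster point of the projections \<open>c r\<close>.\<close>
    ultimately obtain z where z: "inf (nhds z) (filtermap c F) \<noteq> bot"
      using compact_cball[of "0::'a" R] unfolding compact_filter by blast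
    have freq: "\<exists>r. Q r \<and> dist z (c r) < \<delta>" if "eventually Q F" "0 < \<delta>" for Q \<delta>
    proof (rule ccontr)
      assume neg: "\<not> ?thesis"
      have "eventually (\<lambda>w. dist w z < \<delta>) (nhds z)" using that(2) by (auto simp: eventually_nhds_metric)
      moreover have "eventually (\<lambda>w. \<not> dist w z < \<delta>) (filtermap c F)"
        unfolding eventually_filtermap using that(1)
        by eventually_elim (use neg in \<open>auto simp: dist_commute\<close>)
      ultimately have "eventually (\<lambda>_. False) (inf (nhds z) (filtermap c F))"
        unfolding eventually_inf by blast
      then show False using z by (simp add: eventually_False)
    qed
    have "z \<in> L"
    proof (rule L_I)
      fix e :: real assume "0 < e"
      then obtain Q where Q: "eventually Q F" "\<And>r r' y. Q r \<Longrightarrow> Q r' \<Longrightarrow> y\<in>N r \<Longrightarrow> infdist y (N r') \<le> e / 2"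
        using Cauchy[of "e / 2"] by auto
      obtain r1 where r1: "P r1 \<and> Q r1" "dist z (c r1) < e / 2"
        using freq[OF eventually_conj[OF P(1) Q(1)], of "e / 2"] \<open>0 < e\<close> by auto
      show "\<forall>\<^sub>F r in F. infdist z (N r) \<le> e"
        using Q(1)
      proof eventually_elim
        case (elim r)
        have "infdist (c r1) (N r) \<le> e / 2" using Q(2) elim r1 c by blast
        then show ?case using infdist_triangle[of z "N r" "c r1"] r1(2) by linarith
      qed
    qed
    moreover have "dist y z \<le> \<eta>"
    proof (rule field_le_epsilon)
      fix e :: real assume "0 < e"
      from freq[OF P(1) this] obtain r where "P r" "dist z (c r) < e" by blast
      then show "dist y z \<le> \<eta> + e" using c(2)[of r] dist_triangle[of y z "c r"] by (simp add: dist_commute)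
    qed
    ultimately show ?thesis by blast
  qed
  have "convex L"
  proof (rule convexI)
    fix a b and u v :: real assume ab: "a \<in> L" "b \<in> L" and uv: "0 \<le> u" "0 \<le> v" "u + v = 1"
    show "u *\<^sub>R a + v *\<^sub>R b \<in> L"
    proof (rule L_I)
      fix e :: real assume "0 < e"
      show "\<forall>\<^sub>F r in F. infdist (u *\<^sub>R a + v *\<^sub>R b) (N r) \<le> e"
        using L_D[OF ab(1) \<open>0 < e\<close>] L_D[OF ab(2) \<open>0 < e\<close>] N
      proof eventually_elim
        case (elim r)
        define p q where "p = closest_point (N r) a" and "q = closest_point (N r) b"
        have pq: "p \<in> N r" "q \<in> N r" "dist a p \<le> e" "dist b q \<le> e"
          using elim by (auto simp: p_def q_def closest_point_in_set dist_closest_point_eq_infdist)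
        then have "u *\<^sub>R p + v *\<^sub>R q \<in> N r" using elim uv by (auto simp: convex_def)
        then have "infdist (u *\<^sub>R a + v *\<^sub>R b) (N r) \<le> norm (u *\<^sub>R (a - p) + v *\<^sub>R (b - q))"
          using infdist_le[of "u *\<^sub>R p + v *\<^sub>R q" "N r" "u *\<^sub>R a + v *\<^sub>R b"]
          by (simp add: dist_norm algebra_simps)
        also have "\<dots> \<le> u * norm (a - p) + v * norm (b - q)"
          using norm_triangle_ineq[of "u *\<^sub>R (a - p)" "v *\<^sub>R (b - q)"] uv by simp
        also have "\<dots> \<le> u * e + v * e"
          using pq uv by (intro add_mono mult_left_mono) (auto simp: dist_norm)
        also have "\<dots> = e" using uv by (simp flip: distrib_right)
        finally show ?case .
      qed
    qed
  qed
  moreover have "closed L"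
  proof -
    have "z \<in> L" if approx: "\<And>e. 0 < e \<Longrightarrow> \<exists>y\<in>L. dist y z < e" for z
    proof (rule L_I)
      fix e :: real assume "0 < e"
      then obtain y where y: "y \<in> L" "dist y z < e / 2" using approx[of "e / 2"] by auto
      have "0 < e / 2" using \<open>0 < e\<close> by simp
      from L_D[OF y(1) this] show "\<forall>\<^sub>F r in F. infdist z (N r) \<le> e"
      proof eventually_elim
        case (elim r)
        then show ?case using infdist_triangle[of z "N r" y] y(2) by (simp add: dist_commute)
      qed
    qed
    then have "closure L \<subseteq> L" by (auto simp: closure_approachable)
    then show ?thesis by (simp add: closure_subset_eq)
  qed
  moreover have "L \<noteq> {}"
  proof -
    obtain P where P: "eventually P F" "\<And>r. P r \<Longrightarrow> closed (N r) \<and> N r \<noteq> {} \<and> N r \<subseteq> cball 0 R"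
      "\<And>r r' y. P r \<Longrightarrow> P r' \<Longrightarrow> y\<in>N r \<Longrightarrow> infdist y (N r') \<le> 1" using Cauchy'[of 1] by auto
    obtain r where "P r" using P(1) assms(1) eventually_happens' by blast
    then obtain y where "y \<in> N r" using P(2) by blast
    then show ?thesis using near[OF P(1,2), of y 1] P(3) \<open>P r\<close> by blast
  qed
  moreover have "hausdorff_tendsto N L F"
  proof (rule hausdorff_tendstoI[OF \<open>closed L\<close> \<open>L \<noteq> {}\<close>])
    fix \<eta> :: real assume "0 < \<eta>"
    then have "0 < \<eta> / 2" by simp
    from Cauchy'[OF this] obtain P where P: "eventually P F"
      "\<And>r. P r \<Longrightarrow> closed (N r) \<and> N r \<noteq> {} \<and> N r \<subseteq> cball 0 R"
      "\<And>r r' y. P r \<Longrightarrow> P r' \<Longrightarrow> y\<in>N r \<Longrightarrow> infdist y (N r') \<le> \<eta> / 2" by auto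
    show "\<forall>\<^sub>F r in F. (\<forall>y\<in>N r. infdist y L \<le> \<eta>) \<and> (\<forall>y\<in>L. infdist y (N r) \<le> \<eta>)"
      using P(1)
    proof eventually_elim
      case (elim r)
      have "infdist y L \<le> \<eta>" if y: "y \<in> N r" for y
      proof -
        obtain z where "z \<in> L" "dist y z \<le> \<eta> / 2" using near[OF P(1,2), of y "\<eta> / 2"] P(3) elim y by blast
        then show ?thesis using infdist_le[of z L y] \<open>0 < \<eta>\<close> by linarith
      qed
      moreover have "infdist y (N r) \<le> \<eta>" if y: "y \<in> L" for y
      proof -
        obtain r' where r': "P r'" "infdist y (N r') < \<eta> / 2"
          using eventually_happens'[OF assms(1) eventually_conj[OF P(1) L_D[OF y \<open>0 < \<eta> / 2\<close>]]] by blast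
        define c where "c = closest_point (N r') y"
        have "c \<in> N r'" "dist y c < \<eta> / 2"
          using r' P(2)[OF r'(1)] by (auto simp: c_def closest_point_in_set dist_closest_point_eq_infdist)
        then show ?thesis using P(3)[OF r'(1) elim, of c] infdist_triangle[of y "N r" c] by linarith
      qed
      ultimately show ?case by blast
    qed
  qed
  ultimately show ?thesis by blast
qed

lemma hausdorff_limit_exists_if_real_support_convergent:
  fixes N :: "'b \<Rightarrow> 'a::euclidean_space set"
  assumes "F \<noteq> bot" and W: "cball 0 1 \<subseteq> closure W"
    and N: "\<forall>\<^sub>F r in F. closed (N r) \<and> convex (N r) \<and> N r \<noteq> {} \<and> N r \<subseteq> cball 0 R"
    and lim: "\<And>x. x \<in> W \<Longrightarrow> \<exists>l. ((\<lambda>r. real_support x (N r)) \<longlongrightarrow> l) F"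
  shows "\<exists>L. convex L \<and> hausdorff_tendsto N L F"
proof (rule hausdorff_Cauchy_imp_tendsto[OF assms(1) N])
  obtain l where l: "\<And>x. x \<in> W \<Longrightarrow> ((\<lambda>r. real_support x (N r)) \<longlongrightarrow> l x) F"
    using lim by metis
  fix \<eta> :: real assume "0 < \<eta>"
  define R' where "R' = \<bar>R\<bar> + 1"
  have R': "0 < R'" "cball 0 R \<subseteq> cball (0::'a) R'" by (auto simp: R'_def)
  define \<epsilon> where "\<epsilon> = \<eta> / (4 * R')"
  have \<epsilon>: "0 < \<epsilon>" "\<eta> / 2 + 2 * R' * \<epsilon> = \<eta>" using R' \<open>0 < \<eta>\<close> by (auto simp: \<epsilon>_def field_simps)
  obtain K where K: "finite K" "K \<subseteq> W" "cball 0 1 \<subseteq> (\<Union>x\<in>K. ball x \<epsilon>)"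
    using finite_net_of_dense[OF W \<epsilon>(1)] by blast
  \<comment> \<open>Two indices each deviate from the limit by less than \<eta>/4 on the net, hence
    from each other by less than \<eta>/2; the other half of \<eta> is the net error.\<close>
  have "\<forall>\<^sub>F r in F. \<forall>x\<in>K. dist (real_support x (N r)) (l x) < \<eta> / 4"
    using K l \<open>0 < \<eta>\<close> by (intro eventually_ball_finite ballI tendstoD) auto
  then have ev: "\<forall>\<^sub>F r in F. (\<forall>x\<in>K. dist (real_support x (N r)) (l x) < \<eta> / 4) \<and>
      closed (N r) \<and> convex (N r) \<and> N r \<noteq> {} \<and> N r \<subseteq> cball 0 R'"
    using N by eventually_elim (use R' in blast)
  show "\<exists>P. eventually P F \<and> (\<forall>r r'. P r \<longrightarrow> P r' \<longrightarrow> (\<forall>y\<in>N r. infdist y (N r') \<le> \<eta>))"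
  proof (rule exI, rule conjI[OF ev], intro allI impI ballI, elim conjE)
    fix r r' y
    assume r: "\<forall>x\<in>K. dist (real_support x (N r)) (l x) < \<eta> / 4" "N r \<subseteq> cball 0 R'" "y \<in> N r"
      and r': "\<forall>x\<in>K. dist (real_support x (N r')) (l x) < \<eta> / 4" "closed (N r')" "convex (N r')"
        "N r' \<noteq> {}" "N r' \<subseteq> cball 0 R'"
    have "infdist y (N r') \<le> \<eta> / 2 + 2 * R' * \<epsilon>"
    proof (rule infdist_le_if_real_support_close_on_net[OF r'(2-5) r(2,3) K(3)])
      show "real_support x (N r) \<le> real_support x (N r') + \<eta> / 2" if "x \<in> K" for x
        using r(1)[rule_format, OF that] r'(1)[rule_format, OF that] unfolding dist_real_def by linarith
    qed (use \<epsilon> \<open>0 < \<eta>\<close> in auto)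
    then show "infdist y (N r') \<le> \<eta>" using \<epsilon>(2) by simp
  qed
qed

text \<open>Upper bounds in the directions b and -b confine each coordinate to [-B, B]; the
  dimension factor comes from bounding the norm by the sum of the coordinates.\<close>

lemma subset_cball_if_real_support_le:
  fixes C :: "'a::euclidean_space set" and B :: real
  assumes "bounded C" "\<And>b. b \<in> Basis \<Longrightarrow> real_support b C \<le> B \<and> real_support (- b) C \<le> B"
  shows "C \<subseteq> cball 0 (DIM('a) * B)"
proof
  fix y assume y: "y \<in> C"
  have "\<bar>y \<bullet> b\<bar> \<le> B" if b: "b \<in> Basis" for b
    using real_support_upper[OF assms(1) y, of b] real_support_upper[OF assms(1) y, of "- b"] assms(2)[OF b]
    by (auto simp: inner_commute abs_le_iff)
  then have "(\<Sum>b\<in>Basis. \<bar>y \<bullet> b\<bar>) \<le> (\<Sum>b\<in>(Basis::'a set). B)" by (rule sum_mono)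
  then show "y \<in> cball 0 (DIM('a) * B)" using norm_le_l1[of y] by simp
qed

section \<open>Support functions of random sets\<close>

text \<open>Measurability is defined by hitting closed sets; an open set is a countable union of
  closed boxes, so hitting it is a countable union of such events. Strict inequalities for suprema
  and infima over the random set are of this open type.\<close>

lemma set_random_variable_hits_open:
  fixes \<Xi> :: "'w \<Rightarrow> 'a::euclidean_space set"
  assumes "set_random_variable G \<Xi>" "open U"
  shows "{\<omega>\<in>space G. \<Xi> \<omega> \<inter> U \<noteq> {}} \<in> sets G"
proof -
  obtain D where D: "countable D" "D \<subseteq> Pow U" "\<And>X. X \<in> D \<Longrightarrow> \<exists>a b. X = cbox a b" "\<Union>D = U"
    using open_countable_Union_open_cbox[OF assms(2)] by metis
  have eq: "{\<omega>\<in>space G. \<Xi> \<omega> \<inter> U \<noteq> {}} = (\<Union>X\<in>D. {\<omega>\<in>space G. \<Xi> \<omega> \<inter> X \<noteq> {}})"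
    using D(4) by blast
  have "{\<omega>\<in>space G. \<Xi> \<omega> \<inter> X \<noteq> {}} \<in> sets G" if "X \<in> D" for X
    using D(3)[OF that] assms(1) closed_cbox by (auto simp: set_random_variable_def)
  then show ?thesis unfolding eq by (intro sets.countable_UN'[OF D(1)]) auto
qed

lemma support_fun_measurable:
  assumes "set_random_variable G \<Xi>"
  shows "(\<lambda>\<omega>. support_fun x (\<Xi> \<omega>)) \<in> borel_measurable G"
proof (rule borel_measurableI_greater)
  fix c :: ereal
  have "open {y. c < ereal (x \<bullet> y)}" by (intro open_Collect_less continuous_intros)
  from set_random_variable_hits_open[OF assms this]
  show "{\<omega>\<in>space G. c < support_fun x (\<Xi> \<omega>)} \<in> sets G"
    by (simp add: support_fun_def less_SUP_iff Int_def set_eq_iff Bex_def)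
qed

lemma set_norm_measurable:
  assumes "set_random_variable G \<Xi>"
  shows "(\<lambda>\<omega>. set_norm (\<Xi> \<omega>)) \<in> borel_measurable G"
proof (rule borel_measurableI_greater)
  fix c :: ennreal
  have "open {y. c < ennreal (norm y)}"
    by (intro open_Collect_less continuous_on_ennreal continuous_intros)
  from set_random_variable_hits_open[OF assms this]
  show "{\<omega>\<in>space G. c < set_norm (\<Xi> \<omega>)} \<in> sets G"
    by (simp add: set_norm_def less_SUP_iff Int_def set_eq_iff Bex_def)
qed

lemma infdist_measurable:
  assumes "set_random_variable G \<Xi>"
  shows "(\<lambda>\<omega>. infdist z (\<Xi> \<omega>)) \<in> borel_measurable G"
proof (rule borel_measurableI_less)
  fix c :: real
  have "{\<omega>\<in>space G. infdist z (\<Xi> \<omega>) < c} = {\<omega>\<in>space G. \<Xi> \<omega> \<inter> ball z c \<noteq> {}}"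
  proof (intro Collect_cong conj_cong refl)
    fix \<omega> assume "\<omega> \<in> space G"
    then have ne: "\<Xi> \<omega> \<noteq> {}" using assms by (auto simp: set_random_variable_def)
    then show "infdist z (\<Xi> \<omega>) < c \<longleftrightarrow> \<Xi> \<omega> \<inter> ball z c \<noteq> {}"
      using cINF_less_iff[OF ne, of "dist z" c] by (auto simp: infdist_notempty intro: bdd_belowI2[of _ 0])
  qed
  then show "{\<omega>\<in>space G. infdist z (\<Xi> \<omega>) < c} \<in> sets G"
    using set_random_variable_hits_open[OF assms open_ball] by simp
qed

text \<open>The projection lies in the closed set -U exactly when, for every rational q above the
  distance, the random set meets -U inside the ball of radius q about z. One direction is clear; for
  the other, a nearest point in the intersection with -U has the minimal distance and, by convexity,
  is the projection.\<close>

lemma closest_point_measurable: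
  fixes \<Xi> :: "'w \<Rightarrow> 'a::euclidean_space set"
  assumes \<Xi>: "set_random_variable G \<Xi>" and convex: "\<And>\<omega>. \<omega> \<in> space G \<Longrightarrow> convex (\<Xi> \<omega>)"
  shows "(\<lambda>\<omega>. closest_point (\<Xi> \<omega>) z) \<in> borel_measurable G"
proof (rule borel_measurableI)
  fix U :: "'a set" assume "open U"
  then have C: "closed (- U)" by (simp add: closed_Compl)
  have closed: "closed (\<Xi> \<omega>)" "\<Xi> \<omega> \<noteq> {}" if "\<omega> \<in> space G" for \<omega>
    using \<Xi> that by (auto simp: set_random_variable_def)
  let ?p = "\<lambda>\<omega>. closest_point (\<Xi> \<omega>) z"
  have eq: "{\<omega>\<in>space G. ?p \<omega> \<in> - U} = {\<omega>\<in>space G. \<forall>q\<in>\<rat>. q \<le> infdist z (\<Xi> \<omega>) \<or> \<Xi> \<omega> \<inter> (- U \<inter> cball z q) \<noteq> {}}"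
  proof (intro Collect_cong conj_cong refl iffI)
    fix \<omega> assume w: "\<omega> \<in> space G" and p: "?p \<omega> \<in> - U"
    show "\<forall>q\<in>\<rat>. q \<le> infdist z (\<Xi> \<omega>) \<or> \<Xi> \<omega> \<inter> (- U \<inter> cball z q) \<noteq> {}"
      using p closest_point_in_set[OF closed[OF w], of z] dist_closest_point_eq_infdist[OF closed[OF w], of z]
      by (force simp: mem_cball)
  next
    fix \<omega> assume w: "\<omega> \<in> space G"
      and *: "\<forall>q\<in>\<rat>. q \<le> infdist z (\<Xi> \<omega>) \<or> \<Xi> \<omega> \<inter> (- U \<inter> cball z q) \<noteq> {}"
    define p' where "p' = closest_point (\<Xi> \<omega> \<inter> - U) z"
    have cl: "closed (\<Xi> \<omega> \<inter> - U)" using closed[OF w] C by blast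
    have "infdist z (\<Xi> \<omega>) < infdist z (\<Xi> \<omega>) + 1" by simp
    from Rats_dense_in_real[OF this] have ne: "\<Xi> \<omega> \<inter> - U \<noteq> {}" using * by fastforce
    have p': "p' \<in> \<Xi> \<omega>" "p' \<in> - U"
      using closest_point_in_set[OF cl ne, of z] by (auto simp: p'_def)
    have "dist z p' \<le> infdist z (\<Xi> \<omega>)"
    proof (rule ccontr)
      assume "\<not> ?thesis"
      then obtain q where q: "q \<in> \<rat>" "infdist z (\<Xi> \<omega>) < q" "q < dist z p'"
        using Rats_dense_in_real[of "infdist z (\<Xi> \<omega>)" "dist z p'"] by auto
      then obtain y where "y \<in> \<Xi> \<omega> \<inter> - U" "dist z y \<le> q" using * by fastforce
      then show False using closest_point_le[OF cl, of y z] q(3) by (simp add: p'_def)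
    qed
    then have "\<forall>y\<in>\<Xi> \<omega>. dist z p' \<le> dist z y" using infdist_le order_trans by metis
    then have "p' = ?p \<omega>" by (intro closest_point_unique[OF convex[OF w] closed(1)[OF w] p'(1)])
    then show "?p \<omega> \<in> - U" using p'(2) by simp
  qed
  have hit: "{\<omega>\<in>space G. \<Xi> \<omega> \<inter> (- U \<inter> cball z q) \<noteq> {}} \<in> sets G" for q
    using \<Xi> C closed_cball closed_Int unfolding set_random_variable_def by blast
  have [measurable]: "Measurable.pred G (\<lambda>\<omega>. \<Xi> \<omega> \<inter> (- U \<inter> cball z q) \<noteq> {})" for q
    using hit[of q] by (simp only: pred_def)
  note infdist_measurable[OF \<Xi>, measurable]
  have "{\<omega>\<in>space G. q \<le> infdist z (\<Xi> \<omega>) \<or> \<Xi> \<omega> \<inter> (- U \<inter> cball z q) \<noteq> {}} \<in> sets G" for q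
    by measurable
  then have "{\<omega>\<in>space G. ?p \<omega> \<in> - U} \<in> sets G"
    unfolding eq by (intro sets.sets_Collect_countable_All' countable_rat)
  then have "space G - {\<omega>\<in>space G. ?p \<omega> \<in> - U} \<in> sets G" by blast
  moreover have "space G - {\<omega>\<in>space G. ?p \<omega> \<in> - U} = ?p -` U \<inter> space G" by auto
  ultimately show "?p -` U \<inter> space G \<in> sets G" by simp
qed

text \<open>Points of \<open>C\<close> that are closest to the far away point \<open>n x\<close> nearly maximise the inner product
  with \<open>x\<close>; this yields measurable selections almost attaining the support function.\<close>

lemma tendsto_real_support_closest_point:
  fixes C :: "'a::euclidean_space set"
  assumes "closed C" "C \<noteq> {}" "bounded C"
  shows "(\<lambda>n. x \<bullet> closest_point C (real (Suc n) *\<^sub>R x)) \<longlonglongrightarrow> real_support x C"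
proof -
  obtain R where R: "\<And>y. y \<in> C \<Longrightarrow> norm y \<le> R" using assms(3) bounded_iff by blast
  define p where "p n = closest_point C (real (Suc n) *\<^sub>R x)" for n
  have p: "p n \<in> C" for n unfolding p_def by (rule closest_point_in_set[OF assms(1,2)])
  have lower: "real_support x C \<le> x \<bullet> p n + R\<^sup>2 * (1 / real (Suc n))" for n
  proof (rule real_support_least[OF assms(3,2)])
    fix y assume y: "y \<in> C"
    let ?n = "real (Suc n)"
    have "dist (?n *\<^sub>R x) (p n) \<le> dist (?n *\<^sub>R x) y"
      unfolding p_def by (rule closest_point_le[OF assms(1) y])
    then have "(norm (?n *\<^sub>R x - p n))\<^sup>2 \<le> (norm (?n *\<^sub>R x - y))\<^sup>2"
      by (simp add: dist_norm power_mono)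
    then have "p n \<bullet> p n - 2 * ?n * (x \<bullet> p n) \<le> y \<bullet> y - 2 * ?n * (x \<bullet> y)"
      by (simp add: power2_norm_eq_inner inner_diff_left inner_diff_right inner_commute algebra_simps)
    moreover have "y \<bullet> y \<le> R\<^sup>2"
      using R[OF y] by (simp flip: power2_norm_eq_inner add: power_mono)
    moreover have "0 \<le> p n \<bullet> p n" by simp
    ultimately have "2 * ?n * (x \<bullet> y) \<le> 2 * ?n * (x \<bullet> p n) + R\<^sup>2" by linarith
    then have "2 * (x \<bullet> y) \<le> 2 * (x \<bullet> p n) + R\<^sup>2 * (1 / ?n)"
      by (simp add: field_simps)
    moreover have "0 \<le> R\<^sup>2 * (1 / ?n)" by simp
    ultimately show "x \<bullet> y \<le> x \<bullet> p n + R\<^sup>2 * (1 / ?n)" by linarith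
  qed
  have upper: "x \<bullet> p n \<le> real_support x C" for n by (rule real_support_upper[OF assms(3) p])
  have "(\<lambda>n. real_support x C - R\<^sup>2 * (1 / real (Suc n))) \<longlonglongrightarrow> real_support x C - R\<^sup>2 * 0"
    by (intro tendsto_diff tendsto_mult tendsto_const LIMSEQ_Suc lim_1_over_n)
  then have lim: "(\<lambda>n. real_support x C - R\<^sup>2 * (1 / real (Suc n))) \<longlonglongrightarrow> real_support x C" by simp
  have "real_support x C - R\<^sup>2 * (1 / real (Suc n)) \<le> x \<bullet> p n" for n using lower[of n] by linarith
  then have "(\<lambda>n. x \<bullet> p n) \<longlonglongrightarrow> real_support x C"
    using upper by (intro tendsto_sandwich[OF _ _ lim tendsto_const]) auto
  then show ?thesis by (simp only: p_def)
qed

lemma subset_cball_set_norm: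
  assumes "set_norm C < \<infinity>"
  shows "C \<subseteq> cball 0 (enn2real (set_norm C))"
proof
  fix y assume "y \<in> C"
  then have "ennreal (norm y) \<le> set_norm C" unfolding set_norm_def by (rule SUP_upper)
  then have "norm y \<le> enn2real (set_norm C)"
    using assms by (metis enn2real_mono enn2real_ennreal norm_ge_zero infinity_ennreal_def)
  then show "y \<in> cball 0 (enn2real (set_norm C))" by simp
qed

section \<open>Integrably bounded convex random sets\<close>

locale convex_bounded_set_rv = prob_space M for M :: "'w measure" +
  fixes G :: "'w measure" and \<Xi> :: "'w \<Rightarrow> 'a::euclidean_space set"
  assumes subalgebra: "subalgebra M G" and rv: "set_random_variable G \<Xi>"
    and convex: "\<And>\<omega>. \<omega> \<in> space M \<Longrightarrow> convex (\<Xi> \<omega>)" and int_bounded: "integrably_bounded_rv M \<Xi>"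
begin

lemma space_G: "space G = space M" and sets_G: "sets G \<subseteq> sets M"
  using subalgebra by (auto simp: subalgebra_def)

lemma closed_nonempty: "\<omega> \<in> space M \<Longrightarrow> closed (\<Xi> \<omega>)" "\<omega> \<in> space M \<Longrightarrow> \<Xi> \<omega> \<noteq> {}"
  using rv by (auto simp: set_random_variable_def space_G)

text \<open>An infinite norm is sent to 0, so the random set lies in the ball of this radius only
  almost surely. The radius is the integrable majorant for all selections and, up to the factor |x|,
  for the support function.\<close>

abbreviation radius :: "'w \<Rightarrow> real" where
  "radius \<omega> \<equiv> enn2real (set_norm (\<Xi> \<omega>))"

abbreviation support_rv :: "'a \<Rightarrow> 'w \<Rightarrow> real" where
  "support_rv x \<omega> \<equiv> real_support x (\<Xi> \<omega>)"

lemma set_norm_measurable_M [measurable]: "(\<lambda>\<omega>. set_norm (\<Xi> \<omega>)) \<in> borel_measurable M"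
  by (rule measurable_from_subalg[OF subalgebra set_norm_measurable[OF rv]])

lemma AE_subset_cball: "AE \<omega> in M. \<Xi> \<omega> \<subseteq> cball 0 (radius \<omega>)"
proof -
  have "AE \<omega> in M. set_norm (\<Xi> \<omega>) \<noteq> \<infinity>"
    using int_bounded by (intro nn_integral_PInf_AE) (auto simp: integrably_bounded_rv_def)
  then show ?thesis
    by eventually_elim (intro subset_cball_set_norm, simp add: less_top)
qed

lemma AE_bounded: "AE \<omega> in M. bounded (\<Xi> \<omega>)"
  using AE_subset_cball by eventually_elim (rule bounded_subset[OF bounded_cball])

lemma integrable_radius: "integrable M radius"
proof (rule integrableI_bounded)
  have "(\<integral>\<^sup>+ \<omega>. ennreal (norm (radius \<omega>)) \<partial>M) \<le> (\<integral>\<^sup>+ \<omega>. set_norm (\<Xi> \<omega>) \<partial>M)"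
    by (intro nn_integral_mono) (simp add: ennreal_enn2real_if)
  then show "(\<integral>\<^sup>+ \<omega>. ennreal (norm (radius \<omega>)) \<partial>M) < \<infinity>"
    using int_bounded by (auto simp: integrably_bounded_rv_def)
qed measurable

lemma support_rv_measurable: "support_rv x \<in> borel_measurable G"
  unfolding real_support_def using support_fun_measurable[OF rv] by measurable

lemma integrable_support_rv: "integrable M (support_rv x)"
proof (rule Bochner_Integration.integrable_bound[where f="\<lambda>\<omega>. norm x * radius \<omega>"])
  show "AE \<omega> in M. norm (support_rv x \<omega>) \<le> norm (norm x * radius \<omega>)"
    using AE_subset_cball AE_space
  proof eventually_elim
    case (elim \<omega>)
    then show ?case using abs_real_support_le[OF elim(1) closed_nonempty(2), of x] by (simp add: abs_mult)
  qed
qed (use integrable_radius measurable_from_subalg[OF subalgebra support_rv_measurable] in auto)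

lemma selection_le_support_rv:
  assumes "AE \<omega> in M. \<xi> \<omega> \<in> \<Xi> \<omega>"
  shows "AE \<omega> in M. x \<bullet> \<xi> \<omega> \<le> support_rv x \<omega>"
  using assms AE_bounded by eventually_elim (rule real_support_upper)

abbreviation far_selection :: "'a \<Rightarrow> nat \<Rightarrow> 'w \<Rightarrow> 'a" where
  "far_selection x n \<omega> \<equiv> closest_point (\<Xi> \<omega>) (real (Suc n) *\<^sub>R x)"

lemma far_selection_in: "\<omega> \<in> space M \<Longrightarrow> far_selection x n \<omega> \<in> \<Xi> \<omega>"
  by (rule closest_point_in_set[OF closed_nonempty])

lemma far_selection_measurable: "far_selection x n \<in> borel_measurable G"
  using closest_point_measurable[OF rv] convex by (simp add: space_G)

lemma integrable_far_selection: "integrable M (far_selection x n)"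
proof (rule Bochner_Integration.integrable_bound[OF integrable_radius])
  show "AE \<omega> in M. norm (far_selection x n \<omega>) \<le> norm (radius \<omega>)"
    using AE_subset_cball AE_space
    by eventually_elim (use far_selection_in in fastforce)
qed (rule measurable_from_subalg[OF subalgebra far_selection_measurable])

lemma far_selection_integrable_selection: "far_selection x n \<in> integrable_selections M G \<Xi>"
  using integrable_far_selection far_selection_measurable far_selection_in
  by (auto simp: integrable_selections_def)

lemma integrable_selections_mono: "integrable_selections M G \<Xi> \<subseteq> integrable_selections M M \<Xi>"
  using measurable_from_subalg[OF subalgebra] by (auto simp: integrable_selections_def)

lemma tendsto_integral_far_selection:
  assumes "A \<in> sets M"
  shows "(\<lambda>n. \<integral>\<omega>. indicator A \<omega> * (x \<bullet> far_selection x n \<omega>) \<partial>M) \<longlonglongrightarrow>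
    (\<integral>\<omega>. indicator A \<omega> * support_rv x \<omega> \<partial>M)"
proof (rule integral_dominated_convergence[where w="\<lambda>\<omega>. norm x * radius \<omega>"])
  show "AE \<omega> in M. (\<lambda>n. indicator A \<omega> * (x \<bullet> far_selection x n \<omega>)) \<longlonglongrightarrow> indicator A \<omega> * support_rv x \<omega>"
    using AE_bounded AE_space
    by eventually_elim (intro tendsto_mult tendsto_const tendsto_real_support_closest_point closed_nonempty)
  show "AE \<omega> in M. norm (indicator A \<omega> * (x \<bullet> far_selection x n \<omega>)) \<le> norm x * radius \<omega>" for n
    using AE_subset_cball AE_space
  proof eventually_elim
    case (elim \<omega>)
    then have "norm (far_selection x n \<omega>) \<le> radius \<omega>" using far_selection_in by fastforce
    then have "\<bar>x \<bullet> far_selection x n \<omega>\<bar> \<le> norm x * radius \<omega>"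
      using Cauchy_Schwarz_ineq2[of x "far_selection x n \<omega>"] by (meson mult_left_mono norm_ge_zero order_trans)
    then show ?case by (auto simp: indicator_def)
  qed
  show "integrable M (\<lambda>\<omega>. norm x * radius \<omega>)" using integrable_radius by simp
next
  note [measurable] = assms measurable_from_subalg[OF subalgebra support_rv_measurable]
    measurable_from_subalg[OF subalgebra far_selection_measurable]
  show "(\<lambda>\<omega>. indicator A \<omega> * support_rv x \<omega>) \<in> borel_measurable M" by measurable
  show "(\<lambda>\<omega>. indicator A \<omega> * (x \<bullet> far_selection x n \<omega>)) \<in> borel_measurable M" for n by measurable
qed

text \<open>Supremum and expectation are interchanged. Each selection stays below the support
  function, and the closure in \<open>set_expectation\<close> does no harm because a half-space is
  closed. Conversely the far selections attain the expected support function in the limit.\<close>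

lemma support_fun_set_expectation:
  "support_fun x (set_expectation M \<Xi>) = ereal (\<integral>\<omega>. support_rv x \<omega> \<partial>M)"
proof (rule antisym)
  have sel: "x \<bullet> (\<integral>\<omega>. \<xi> \<omega> \<partial>M) \<le> (\<integral>\<omega>. support_rv x \<omega> \<partial>M)" if "\<xi> \<in> integrable_selections M M \<Xi>" for \<xi>
  proof -
    have \<xi>: "integrable M \<xi>" "AE \<omega> in M. \<xi> \<omega> \<in> \<Xi> \<omega>" using that by (auto simp: integrable_selections_def)
    have "x \<bullet> (\<integral>\<omega>. \<xi> \<omega> \<partial>M) = (\<integral>\<omega>. x \<bullet> \<xi> \<omega> \<partial>M)" using \<xi>(1) by simp
    also have "\<dots> \<le> (\<integral>\<omega>. support_rv x \<omega> \<partial>M)"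
      using \<xi> selection_le_support_rv integrable_support_rv by (intro integral_mono_AE) auto
    finally show ?thesis .
  qed
  have "set_expectation M \<Xi> \<subseteq> {y. x \<bullet> y \<le> (\<integral>\<omega>. support_rv x \<omega> \<partial>M)}"
    unfolding set_expectation_def
    using sel by (intro closure_minimal closed_halfspace_le) auto
  then show "support_fun x (set_expectation M \<Xi>) \<le> ereal (\<integral>\<omega>. support_rv x \<omega> \<partial>M)"
    unfolding support_fun_def by (intro SUP_least) auto
next
  have "ereal (\<integral>\<omega>. indicator (space M) \<omega> * (x \<bullet> far_selection x n \<omega>) \<partial>M) \<le> support_fun x (set_expectation M \<Xi>)" for n
  proof -
    have "(\<integral>\<omega>. far_selection x n \<omega> \<partial>M) \<in> set_expectation M \<Xi>"
      unfolding set_expectation_def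
      using far_selection_integrable_selection integrable_selections_mono closure_subset by blast
    then have "ereal (x \<bullet> (\<integral>\<omega>. far_selection x n \<omega> \<partial>M)) \<le> support_fun x (set_expectation M \<Xi>)"
      unfolding support_fun_def by (rule SUP_upper)
    moreover have "(\<integral>\<omega>. indicator (space M) \<omega> * (x \<bullet> far_selection x n \<omega>) \<partial>M) = (\<integral>\<omega>. x \<bullet> far_selection x n \<omega> \<partial>M)"
      by (intro Bochner_Integration.integral_cong) auto
    ultimately show ?thesis using integrable_far_selection by simp
  qed
  moreover have "(\<integral>\<omega>. indicator (space M) \<omega> * support_rv x \<omega> \<partial>M) = (\<integral>\<omega>. support_rv x \<omega> \<partial>M)"
    by (intro Bochner_Integration.integral_cong) auto
  ultimately show "ereal (\<integral>\<omega>. support_rv x \<omega> \<partial>M) \<le> support_fun x (set_expectation M \<Xi>)"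
    using tendsto_integral_far_selection[OF sets.top, of x]
    by (intro LIMSEQ_le_const2[of "\<lambda>n. ereal (\<integral>\<omega>. indicator (space M) \<omega> * (x \<bullet> far_selection x n \<omega>) \<partial>M)"]) auto
qed

end

section \<open>Conditional expectations and the support inequality\<close>

lemma (in prob_space)
  assumes "subalgebra M G" and \<xi>: "integrable M \<xi>"
  shows integrable_vec_cond_exp: "integrable M (vec_cond_exp M G \<xi>)"
    and integral_indicator_inner_vec_cond_exp: "A \<in> sets G \<Longrightarrow>
      (\<integral>\<omega>. indicator A \<omega> * (x \<bullet> vec_cond_exp M G \<xi> \<omega>) \<partial>M) = (\<integral>\<omega>. indicator A \<omega> * (x \<bullet> \<xi> \<omega>) \<partial>M)"
proof -
  interpret finite_measure_subalgebra M G using assms(1) by unfold_locales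
  have int: "integrable M (\<lambda>\<omega>. \<xi> \<omega> \<bullet> b)" for b using \<xi> by simp
  note rce = real_cond_exp_int(1)[OF int]
  show "integrable M (vec_cond_exp M G \<xi>)"
    unfolding vec_cond_exp_def[abs_def] using rce by simp
  assume A: "A \<in> sets G"
  then have AM: "A \<in> sets M" using assms(1) by (auto simp: subalgebra_def)
  have intA: "integrable M (\<lambda>\<omega>. indicator A \<omega> * h \<omega>)" if "integrable M h" for h :: "_ \<Rightarrow> real"
    using integrable_real_mult_indicator[OF AM that] by (simp add: mult.commute)
  have "(\<integral>\<omega>. indicator A \<omega> * (x \<bullet> vec_cond_exp M G \<xi> \<omega>) \<partial>M) =
      (\<integral>\<omega>. (\<Sum>b\<in>Basis. (x \<bullet> b) * (indicator A \<omega> * real_cond_exp M G (\<lambda>\<omega>. \<xi> \<omega> \<bullet> b) \<omega>)) \<partial>M)"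
    by (simp add: vec_cond_exp_def inner_sum_right sum_distrib_left mult_ac)
  also have "\<dots> = (\<Sum>b\<in>Basis. (x \<bullet> b) * (\<integral>\<omega>. indicator A \<omega> * real_cond_exp M G (\<lambda>\<omega>. \<xi> \<omega> \<bullet> b) \<omega> \<partial>M))"
    using intA[OF rce] by (subst Bochner_Integration.integral_sum) auto
  also have "\<dots> = (\<Sum>b\<in>Basis. (x \<bullet> b) * (\<integral>\<omega>. indicator A \<omega> * (\<xi> \<omega> \<bullet> b) \<partial>M))"
    using real_cond_exp_intA[OF int A] by (simp add: set_lebesgue_integral_def)
  also have "\<dots> = (\<integral>\<omega>. (\<Sum>b\<in>Basis. (x \<bullet> b) * (indicator A \<omega> * (\<xi> \<omega> \<bullet> b))) \<partial>M)"
    using intA[OF int] by (subst Bochner_Integration.integral_sum) auto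
  also have "\<dots> = (\<integral>\<omega>. indicator A \<omega> * (x \<bullet> \<xi> \<omega>) \<partial>M)"
  proof (intro Bochner_Integration.integral_cong refl)
    show "(\<Sum>b\<in>Basis. (x \<bullet> b) * (indicator A \<omega> * (\<xi> \<omega> \<bullet> b))) = indicator A \<omega> * (x \<bullet> \<xi> \<omega>)" for \<omega>
      unfolding euclidean_inner[of x "\<xi> \<omega>"] by (simp add: sum_distrib_left mult_ac)
  qed
  finally show "(\<integral>\<omega>. indicator A \<omega> * (x \<bullet> vec_cond_exp M G \<xi> \<omega>) \<partial>M) = (\<integral>\<omega>. indicator A \<omega> * (x \<bullet> \<xi> \<omega>) \<partial>M)" .
qed

text \<open>A selection of \<open>\<Phi>\<close> is one of \<open>Y\<close>, hence an L1 limit of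
  conditional expectations of selections \<open>\<eta>\<close> of \<open>\<Xi>\<close>. Integrating
  over \<open>A\<close> in \<open>G\<close> removes the conditioning, and x \<bullet> \<eta> is at
  most the support function of \<open>\<Xi>\<close>. Applying this to the far selections of
  \<open>\<Phi>\<close> and letting n tend to infinity gives the claim.\<close>

lemma support_submartingale_inequality:
  assumes \<Phi>: "convex_bounded_set_rv M G \<Phi>" and \<Xi>: "convex_bounded_set_rv M H \<Xi>"
    and Y: "is_set_cond_exp M G \<Xi> Y" "AE \<omega> in M. \<Phi> \<omega> \<subseteq> Y \<omega>" and A: "A \<in> sets G"
  shows "(\<integral>\<omega>. indicator A \<omega> * real_support x (\<Phi> \<omega>) \<partial>M) \<le> (\<integral>\<omega>. indicator A \<omega> * real_support x (\<Xi> \<omega>) \<partial>M)"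
proof -
  interpret \<Phi>: convex_bounded_set_rv M G \<Phi> by fact
  interpret \<Xi>: convex_bounded_set_rv M H \<Xi> by fact
  have AM: "A \<in> sets M" using A \<Phi>.sets_G by auto
  have intA: "integrable M (\<lambda>\<omega>. indicator A \<omega> * h \<omega>)" if "integrable M h" for h :: "_ \<Rightarrow> real"
    using integrable_real_mult_indicator[OF AM that] by (simp add: mult.commute)
  have "(\<integral>\<omega>. indicator A \<omega> * (x \<bullet> \<xi> \<omega>) \<partial>M) \<le> (\<integral>\<omega>. indicator A \<omega> * real_support x (\<Xi> \<omega>) \<partial>M)"
    if "\<xi> \<in> integrable_selections M G \<Phi>" for \<xi>
  proof (rule field_le_epsilon)
    fix e :: real assume "0 < e"
    have \<xi>: "integrable M \<xi>" using that by (simp add: integrable_selections_def)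
    have "AE \<omega> in M. \<xi> \<omega> \<in> Y \<omega>"
      using that Y(2) by (auto simp: integrable_selections_def elim: AE_mp)
    then have "\<xi> \<in> integrable_selections M G Y" using that by (auto simp: integrable_selections_def)
    then have "\<xi> \<in> L1_closure M G (vec_cond_exp M G ` integrable_selections M M \<Xi>)"
      using Y(1) by (simp add: is_set_cond_exp_def)
    \<comment> \<open>The L1 error is multiplied by |x| through Cauchy-Schwarz; adding 1 covers x =
      0.\<close>
    moreover have "0 < e / (norm x + 1)" using \<open>0 < e\<close> by (simp add: add_nonneg_pos)
    ultimately obtain \<eta> where \<eta>: "\<eta> \<in> integrable_selections M M \<Xi>"
        "(\<integral>\<omega>. norm (\<xi> \<omega> - vec_cond_exp M G \<eta> \<omega>) \<partial>M) < e / (norm x + 1)"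
      unfolding L1_closure_def by blast
    have \<eta>': "integrable M \<eta>" "AE \<omega> in M. \<eta> \<omega> \<in> \<Xi> \<omega>" using \<eta>(1) by (auto simp: integrable_selections_def)
    let ?\<zeta> = "vec_cond_exp M G \<eta>"
    have \<zeta>: "integrable M ?\<zeta>" by (rule \<Phi>.integrable_vec_cond_exp[OF \<Phi>.subalgebra \<eta>'(1)])
    have "(\<integral>\<omega>. indicator A \<omega> * (x \<bullet> \<xi> \<omega>) \<partial>M) \<le>
        (\<integral>\<omega>. indicator A \<omega> * (x \<bullet> ?\<zeta> \<omega>) + norm x * norm (\<xi> \<omega> - ?\<zeta> \<omega>) \<partial>M)"
    proof (rule integral_mono)
      fix \<omega>
      have "x \<bullet> \<xi> \<omega> \<le> x \<bullet> ?\<zeta> \<omega> + norm x * norm (\<xi> \<omega> - ?\<zeta> \<omega>)"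
        using norm_cauchy_schwarz[of x "\<xi> \<omega> - ?\<zeta> \<omega>"] by (simp add: inner_diff_right)
      then show "indicator A \<omega> * (x \<bullet> \<xi> \<omega>) \<le> indicator A \<omega> * (x \<bullet> ?\<zeta> \<omega>) + norm x * norm (\<xi> \<omega> - ?\<zeta> \<omega>)"
        by (auto simp: indicator_def)
    next
      show "integrable M (\<lambda>\<omega>. indicator A \<omega> * (x \<bullet> \<xi> \<omega>))" using \<xi> by (intro intA) auto
      show "integrable M (\<lambda>\<omega>. indicator A \<omega> * (x \<bullet> ?\<zeta> \<omega>) + norm x * norm (\<xi> \<omega> - ?\<zeta> \<omega>))"
        using \<xi> \<zeta> intA[of "\<lambda>\<omega>. x \<bullet> ?\<zeta> \<omega>"] by auto
    qed
    also have "\<dots> = (\<integral>\<omega>. indicator A \<omega> * (x \<bullet> ?\<zeta> \<omega>) \<partial>M) + norm x * (\<integral>\<omega>. norm (\<xi> \<omega> - ?\<zeta> \<omega>) \<partial>M)"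
      using \<xi> \<zeta> intA[of "\<lambda>\<omega>. x \<bullet> ?\<zeta> \<omega>"] by auto
    also have "(\<integral>\<omega>. indicator A \<omega> * (x \<bullet> ?\<zeta> \<omega>) \<partial>M) = (\<integral>\<omega>. indicator A \<omega> * (x \<bullet> \<eta> \<omega>) \<partial>M)"
      by (rule \<Phi>.integral_indicator_inner_vec_cond_exp[OF \<Phi>.subalgebra \<eta>'(1) A])
    also have "\<dots> \<le> (\<integral>\<omega>. indicator A \<omega> * real_support x (\<Xi> \<omega>) \<partial>M)"
    proof (rule integral_mono_AE)
      show "AE \<omega> in M. indicator A \<omega> * (x \<bullet> \<eta> \<omega>) \<le> indicator A \<omega> * real_support x (\<Xi> \<omega>)"
        using \<Xi>.selection_le_support_rv[OF \<eta>'(2), of x] by eventually_elim (simp add: indicator_def)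
    qed (use \<eta>' \<Xi>.integrable_support_rv in \<open>auto intro!: intA\<close>)
    also have "norm x * (\<integral>\<omega>. norm (\<xi> \<omega> - ?\<zeta> \<omega>) \<partial>M) \<le> (norm x + 1) * (\<integral>\<omega>. norm (\<xi> \<omega> - ?\<zeta> \<omega>) \<partial>M)"
      by (intro mult_right_mono) auto
    also have "\<dots> \<le> e"
      using \<eta>(2) by (simp add: add_nonneg_pos pos_less_divide_eq mult.commute less_imp_le)
    finally show "(\<integral>\<omega>. indicator A \<omega> * (x \<bullet> \<xi> \<omega>) \<partial>M) \<le> (\<integral>\<omega>. indicator A \<omega> * real_support x (\<Xi> \<omega>) \<partial>M) + e"
      by simp
  qed
  then show ?thesis
    using \<Phi>.far_selection_integrable_selection
    by (intro LIMSEQ_le_const2[OF \<Phi>.tendsto_integral_far_selection[OF AM]]) auto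
qed

section \<open>The left-continuous modification\<close>

lemma hausdorff_tendsto_cong:
  assumes "\<forall>\<^sub>F r in F. N r = N' r"
  shows "hausdorff_tendsto N L F \<longleftrightarrow> hausdorff_tendsto N' L F"
proof -
  have "\<forall>\<^sub>F r in F. hausdorff_distance (N r) L = hausdorff_distance (N' r) L"
    using assms by eventually_elim simp
  from tendsto_cong[OF this] show ?thesis by (simp add: hausdorff_tendsto_def)
qed

lemma has_left_limit_cong:
  assumes "\<And>r. r \<in> \<rat> \<Longrightarrow> 0 \<le> r \<Longrightarrow> N r = N' r"
  shows "has_left_limit N t L \<longleftrightarrow> has_left_limit N' t L"
  unfolding has_left_limit_def
  by (rule hausdorff_tendsto_cong) (use assms in \<open>auto simp: eventually_at_filter\<close>)

lemma has_right_limit_cong: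
  assumes "\<And>r. r \<in> \<rat> \<Longrightarrow> 0 \<le> r \<Longrightarrow> N r = N' r" "0 \<le> t"
  shows "has_right_limit N t L \<longleftrightarrow> has_right_limit N' t L"
  unfolding has_right_limit_def
  by (rule hausdorff_tendsto_cong) (use assms in \<open>auto simp: eventually_at_filter\<close>)

lemma integrable_selections_cong_AE:
  assumes "AE \<omega> in M. \<Xi> \<omega> = \<Xi>' \<omega>"
  shows "integrable_selections M G \<Xi> = integrable_selections M G \<Xi>'"
proof -
  have "(AE \<omega> in M. \<xi> \<omega> \<in> \<Xi> \<omega>) \<longleftrightarrow> (AE \<omega> in M. \<xi> \<omega> \<in> \<Xi>' \<omega>)" for \<xi>
    using assms by (auto elim: eventually_elim2)
  then show ?thesis by (simp add: integrable_selections_def)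
qed

text \<open>The random set enters only through its integrable selections, which do not see null
  sets. The same version \<open>Y\<close> therefore serves the process and its modification.\<close>

lemma is_set_cond_exp_cong_AE:
  assumes "AE \<omega> in M. \<Xi> \<omega> = \<Xi>' \<omega>"
  shows "is_set_cond_exp M G \<Xi> Y \<longleftrightarrow> is_set_cond_exp M G \<Xi>' Y"
  using integrable_selections_cong_AE[OF assms] by (simp add: is_set_cond_exp_def)

text \<open>The hitting events of the two maps differ only inside a null set. Its subsets are
  measurable by completeness and, being null, belong to \<open>G\<close>.\<close>

lemma set_random_variable_cong_AE:
  fixes \<Xi> \<Xi>' :: "'w \<Rightarrow> 'a::euclidean_space set"
  assumes "complete_measure M" "subalgebra M G" "null_sets M \<subseteq> sets G"
    and \<Xi>: "set_random_variable G \<Xi>" and eq: "AE \<omega> in M. \<Xi> \<omega> = \<Xi>' \<omega>"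
    and \<Xi>': "\<And>\<omega>. \<omega> \<in> space M \<Longrightarrow> closed (\<Xi>' \<omega>) \<and> \<Xi>' \<omega> \<noteq> {}"
  shows "set_random_variable G \<Xi>'"
  unfolding set_random_variable_def
proof (intro conjI allI impI ballI)
  have sp: "space G = space M" using assms(2) by (simp add: subalgebra_def)
  then show "\<omega> \<in> space G \<Longrightarrow> closed (\<Xi>' \<omega>)" "\<omega> \<in> space G \<Longrightarrow> \<Xi>' \<omega> \<noteq> {}" for \<omega>
    using \<Xi>' by auto
  fix C :: "'a set" assume "closed C"
  let ?A = "{\<omega>\<in>space G. \<Xi> \<omega> \<inter> C \<noteq> {}}" and ?A' = "{\<omega>\<in>space G. \<Xi>' \<omega> \<inter> C \<noteq> {}}"
  obtain N where N: "\<And>\<omega>. \<omega> \<in> space M - N \<Longrightarrow> \<Xi> \<omega> = \<Xi>' \<omega>" "N \<in> null_sets M"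
    by (rule AE_E3[OF eq]) blast
  have "?A' \<inter> N \<in> sets M"
    by (rule complete_measure.complete[OF assms(1) _ N(2)]) blast
  then have "?A' \<inter> N \<in> null_sets M" using null_sets_subset[OF N(2)] by blast
  moreover have "?A \<in> sets G" using \<Xi> \<open>closed C\<close> by (simp add: set_random_variable_def)
  ultimately have "(?A - N) \<union> (?A' \<inter> N) \<in> sets G"
    using assms(3) N(2) by (intro sets.Un sets.Diff) auto
  moreover have "?A' = (?A - N) \<union> (?A' \<inter> N)" using N(1) sp by auto
  ultimately show "?A' \<in> sets G" by simp
qed

lemma set_submartingale_cong_AE:
  assumes X: "set_submartingale M F X" and ad: "adapted_set_process F X'"
    and eq: "\<And>t. 0 \<le> t \<Longrightarrow> AE \<omega> in M. X t \<omega> = X' t \<omega>"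
  shows "set_submartingale M F X'"
  unfolding set_submartingale_def
proof (intro conjI allI impI ad)
  show "integrable_set_process M X'"
    using X integrable_selections_cong_AE[OF eq]
    by (simp add: set_submartingale_def integrable_set_process_def set_integrable_rv_def)
  fix s t :: real assume st: "0 \<le> s \<and> s \<le> t"
  then obtain Y where Y: "is_set_cond_exp M (F s) (X t) Y" "AE \<omega> in M. X s \<omega> \<subseteq> Y \<omega>"
    using X unfolding set_submartingale_def by blast
  have "is_set_cond_exp M (F s) (X' t) Y" using Y(1) is_set_cond_exp_cong_AE[OF eq, of t] st by simp
  moreover have "AE \<omega> in M. X' s \<omega> \<subseteq> Y \<omega>" using Y(2) eq[of s] st by (auto elim: eventually_elim2)
  ultimately show "\<exists>Y. is_set_cond_exp M (F s) (X' t) Y \<and> (AE \<omega> in M. X' s \<omega> \<subseteq> Y \<omega>)" by blast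
qed

lemma set_martingale_cong_AE:
  assumes X: "set_martingale M F X" and ad: "adapted_set_process F X'"
    and eq: "\<And>t. 0 \<le> t \<Longrightarrow> AE \<omega> in M. X t \<omega> = X' t \<omega>"
  shows "set_martingale M F X'"
  unfolding set_martingale_def
proof (intro conjI allI impI ad)
  show "integrable_set_process M X'"
    using X integrable_selections_cong_AE[OF eq]
    by (simp add: set_martingale_def integrable_set_process_def set_integrable_rv_def)
  fix s t :: real assume st: "0 \<le> s \<and> s \<le> t"
  then obtain Y where Y: "is_set_cond_exp M (F s) (X t) Y" "AE \<omega> in M. Y \<omega> = X s \<omega>"
    using X unfolding set_martingale_def by blast
  have "is_set_cond_exp M (F s) (X' t) Y" using Y(1) is_set_cond_exp_cong_AE[OF eq, of t] st by simp
  moreover have "AE \<omega> in M. Y \<omega> = X' s \<omega>" using Y(2) eq[of s] st by (auto elim: eventually_elim2)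
  ultimately show "\<exists>Y. is_set_cond_exp M (F s) (X' t) Y \<and> (AE \<omega> in M. Y \<omega> = X' s \<omega>)" by blast
qed

section \<open>Regular paths of the set-valued submartingale\<close>

locale left_continuous_set_submartingale = prob_space M for M :: "'w measure" +
  fixes F :: "real \<Rightarrow> 'w measure" and W :: "'a::euclidean_space set" and X :: "real \<Rightarrow> 'w \<Rightarrow> 'a set"
  assumes filtration: "filtration_nonneg M F" and left_cont: "left_continuous_filtration M F"
    and W: "countable W" "cball 0 1 \<subseteq> closure W"
    and submartingale: "set_submartingale M F X"
    and convex_X: "convex_set_process M X" and bounded_X: "integrably_bounded_set_process M X"
    and exp_left_cont: "\<And>x t. x \<in> W \<Longrightarrow> 0 < t \<Longrightarrow>
      continuous (at_left t) (\<lambda>r. support_fun x (set_expectation M (X r)))"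
begin

lemma convex_bounded_rv: "0 \<le> t \<Longrightarrow> convex_bounded_set_rv M (F t) (X t)"
proof (intro convex_bounded_set_rv.intro convex_bounded_set_rv_axioms.intro prob_space_axioms)
  assume t: "0 \<le> t"
  show "subalgebra M (F t)" using filtration t by (simp add: filtration_nonneg_def)
  show "set_random_variable (F t) (X t)"
    using submartingale t by (simp add: set_submartingale_def adapted_set_process_def)
  show "integrably_bounded_rv M (X t)" using bounded_X t by (simp add: integrably_bounded_set_process_def)
  show "convex (X t \<omega>)" if "\<omega> \<in> space M" for \<omega>
    using convex_X t that by (simp add: convex_set_process_def)
qed

lemma closed_nonempty_convex:
  "0 \<le> t \<Longrightarrow> \<omega> \<in> space M \<Longrightarrow> closed (X t \<omega>) \<and> X t \<omega> \<noteq> {} \<and> convex (X t \<omega>)"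
  using convex_bounded_set_rv.closed_nonempty[OF convex_bounded_rv]
    convex_bounded_set_rv.convex[OF convex_bounded_rv] by blast

lemma support_submartingale: "real_submartingale M F (\<lambda>t \<omega>. real_support x (X t \<omega>))"
  unfolding real_submartingale_def
proof (intro conjI allI impI)
  fix t :: real assume "0 \<le> t"
  then interpret convex_bounded_set_rv M "F t" "X t" by (rule convex_bounded_rv)
  show "(\<lambda>\<omega>. real_support x (X t \<omega>)) \<in> borel_measurable (F t)" by (rule support_rv_measurable)
  show "integrable M (\<lambda>\<omega>. real_support x (X t \<omega>))" by (rule integrable_support_rv)
next
  fix s t A assume *: "0 \<le> s \<and> s \<le> t \<and> A \<in> sets (F s)"
  then obtain Y where Y: "is_set_cond_exp M (F s) (X t) Y" "AE \<omega> in M. X s \<omega> \<subseteq> Y \<omega>"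
    using submartingale unfolding set_submartingale_def by blast
  then show "(\<integral>\<omega>. indicator A \<omega> * real_support x (X s \<omega>) \<partial>M) \<le> (\<integral>\<omega>. indicator A \<omega> * real_support x (X t \<omega>) \<partial>M)"
    using * by (intro support_submartingale_inequality[OF convex_bounded_rv convex_bounded_rv Y]) auto
qed

lemma expectation_support_left_continuous:
  assumes "x \<in> W" "0 < t"
  shows "((\<lambda>r. \<integral>\<omega>. real_support x (X r \<omega>) \<partial>M) \<longlongrightarrow> (\<integral>\<omega>. real_support x (X t \<omega>) \<partial>M)) (at_left t)"
proof -
  note E = convex_bounded_set_rv.support_fun_set_expectation[OF convex_bounded_rv]
  have "((\<lambda>r. support_fun x (set_expectation M (X r))) \<longlongrightarrow> support_fun x (set_expectation M (X t))) (at_left t)"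
    using exp_left_cont[OF assms] by (simp add: continuous_within)
  then have "((\<lambda>r. support_fun x (set_expectation M (X r))) \<longlongrightarrow> ereal (\<integral>\<omega>. real_support x (X t \<omega>) \<partial>M)) (at_left t)"
    using E[of t x] assms(2) by simp
  moreover have "\<forall>\<^sub>F r in at_left t. 0 < r" by (rule order_tendstoD(1)[OF tendsto_ident_at assms(2)])
  then have "\<forall>\<^sub>F r in at_left t. support_fun x (set_expectation M (X r)) = ereal (\<integral>\<omega>. real_support x (X r \<omega>) \<partial>M)"
    by eventually_elim (simp add: E)
  ultimately have "((\<lambda>r. ereal (\<integral>\<omega>. real_support x (X r \<omega>) \<partial>M)) \<longlongrightarrow> ereal (\<integral>\<omega>. real_support x (X t \<omega>) \<partial>M)) (at_left t)"
    by (rule Lim_transform_eventually)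
  then show ?thesis by simp
qed

text \<open>A condition on the whole path in which no time t occurs. It is a countable conjunction,
  hence holds almost surely, and yet it forces one-sided limits at every t.\<close>

definition regular :: "'w \<Rightarrow> bool" where
  "regular \<omega> \<longleftrightarrow> \<omega> \<in> space M \<and>
     (\<forall>T::nat. \<exists>R. \<forall>q\<in>\<rat> \<inter> {0..real T}. X q \<omega> \<subseteq> cball 0 R) \<and>
     (\<forall>x\<in>W. \<forall>T::nat. \<forall>a\<in>\<rat>. \<forall>b\<in>\<rat>. a < b \<longrightarrow>
        (\<exists>m. \<not> upcrosses (\<lambda>q. real_support x (X q \<omega>)) a b (\<rat> \<inter> {0..real T}) m 0))"

text \<open>The real bound is applied in finitely many directions, the basis vectors and their
  negatives, and the resulting bounds are summed into one.\<close>

lemma AE_uniformly_bounded: "AE \<omega> in M. \<exists>R. \<forall>q\<in>\<rat> \<inter> {0..real T}. X q \<omega> \<subseteq> cball 0 R"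
proof -
  have "AE \<omega> in M. \<forall>u\<in>Basis \<union> uminus ` Basis. \<exists>B. \<forall>q\<in>\<rat> \<inter> {0..real T}. real_support u (X q \<omega>) \<le> B"
    using AE_bounded_above[OF prob_space_axioms filtration support_submartingale]
    by (subst AE_ball_countable) (auto simp: countable_finite)
  \<comment> \<open>A bound on \<open>real_support\<close> carries no information where the support
    value is infinite, so boundedness of the single sets is secured separately.\<close>
  moreover have "AE \<omega> in M. \<forall>q\<in>\<rat> \<inter> {0..real T}. bounded (X q \<omega>)"
    using convex_bounded_set_rv.AE_bounded[OF convex_bounded_rv]
    by (subst AE_ball_countable) (auto simp: countable_rat)
  ultimately show ?thesis
  proof eventually_elim
    case (elim \<omega>)
    let ?U = "Basis \<union> uminus ` Basis :: 'a set"
    obtain B where B: "\<And>u q. u \<in> ?U \<Longrightarrow> q \<in> \<rat> \<inter> {0..real T} \<Longrightarrow> real_support u (X q \<omega>) \<le> B u"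
      using elim(1) by metis
    define B' where "B' = (\<Sum>u\<in>?U. \<bar>B u\<bar>)"
    have "B u \<le> B'" if "u \<in> ?U" for u
      using member_le_sum[OF that, of "\<lambda>u. \<bar>B u\<bar>"] by (simp add: B'_def)
    then have "X q \<omega> \<subseteq> cball 0 (DIM('a) * B')" if "q \<in> \<rat> \<inter> {0..real T}" for q
      using that elim(2) B[OF _ that]
      by (intro subset_cball_if_real_support_le conjI; meson UnI1 UnI2 imageI order_trans)
    then show ?case by blast
  qed
qed

lemma AE_regular: "AE \<omega> in M. regular \<omega>"
proof -
  have "AE \<omega> in M. \<forall>T::nat. \<exists>R. \<forall>q\<in>\<rat> \<inter> {0..real T}. X q \<omega> \<subseteq> cball 0 R"
    unfolding AE_all_countable using AE_uniformly_bounded by blast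
  moreover have "AE \<omega> in M. \<forall>x\<in>W. \<forall>T::nat. \<forall>a\<in>\<rat>. \<forall>b\<in>\<rat>. a < b \<longrightarrow>
      (\<exists>m. \<not> upcrosses (\<lambda>q. real_support x (X q \<omega>)) a b (\<rat> \<inter> {0..real T}) m 0)"
    using AE_finite_upcrossings[OF prob_space_axioms filtration support_submartingale]
    by (simp add: AE_ball_countable AE_all_countable countable_rat W(1))
  ultimately show ?thesis using AE_space by eventually_elim (auto simp: regular_def)
qed

context
  fixes \<omega> assumes reg: "regular \<omega>"
begin

lemma regular_space: "\<omega> \<in> space M"
  using reg by (simp add: regular_def)

lemma regular_bounded:
  "\<exists>R. \<forall>q\<in>\<rat> \<inter> {0..real T}. closed (X q \<omega>) \<and> convex (X q \<omega>) \<and> X q \<omega> \<noteq> {} \<and> X q \<omega> \<subseteq> cball 0 R"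
proof -
  obtain R where "\<forall>q\<in>\<rat> \<inter> {0..real T}. X q \<omega> \<subseteq> cball 0 R" using reg unfolding regular_def by blast
  then show ?thesis using closed_nonempty_convex[OF _ regular_space] by (intro exI[of _ R]) auto
qed

lemma regular_support_bounded:
  "\<exists>B. \<forall>q\<in>\<rat> \<inter> {0..real T}. \<bar>real_support x (X q \<omega>)\<bar> \<le> B"
proof -
  obtain R where "\<forall>q\<in>\<rat> \<inter> {0..real T}.
    closed (X q \<omega>) \<and> convex (X q \<omega>) \<and> X q \<omega> \<noteq> {} \<and> X q \<omega> \<subseteq> cball 0 R"
    using regular_bounded by blast
  then show ?thesis by (intro exI[of _ "norm x * R"] ballI abs_real_support_le) auto
qed

lemma regular_finite_upcrossings:
  assumes "x \<in> W" "a \<in> \<rat>" "b \<in> \<rat>" "a < b"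
  shows "\<exists>m. \<not> upcrosses (\<lambda>q. real_support x (X q \<omega>)) a b (\<rat> \<inter> {0..real T}) m 0"
  using reg assms unfolding regular_def by blast

lemma regular_support_left_limit:
  assumes "x \<in> W" "0 < t"
  shows "\<exists>l. ((\<lambda>r. real_support x (X r \<omega>)) \<longlongrightarrow> l) (at t within {r\<in>\<rat>. 0 \<le> r \<and> r < t})"
proof -
  obtain T :: nat where T: "t \<le> T" using real_arch_simple by blast
  obtain B where "\<forall>q\<in>\<rat> \<inter> {0..real T}. \<bar>real_support x (X q \<omega>)\<bar> \<le> B"
    using regular_support_bounded by blast
  then show ?thesis
    using regular_finite_upcrossings[OF assms(1)]
    by (intro left_limit_if_finite_upcrossings[OF assms(2) T]) auto
qed

lemma regular_eventually_left:
  assumes "0 < t"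
  obtains R where "\<forall>\<^sub>F r in at t within {r\<in>\<rat>. 0 \<le> r \<and> r < t}.
    closed (X r \<omega>) \<and> convex (X r \<omega>) \<and> X r \<omega> \<noteq> {} \<and> X r \<omega> \<subseteq> cball 0 R"
proof -
  obtain T :: nat where T: "t \<le> T" using real_arch_simple by blast
  obtain R where R: "\<forall>q\<in>\<rat> \<inter> {0..real T}.
    closed (X q \<omega>) \<and> convex (X q \<omega>) \<and> X q \<omega> \<noteq> {} \<and> X q \<omega> \<subseteq> cball 0 R"
    using regular_bounded by blast
  show thesis by (rule that[of R]) (use R T in \<open>auto simp: eventually_at_filter\<close>)
qed

lemma regular_left_limit:
  assumes "0 < t"
  shows "\<exists>L. convex L \<and> has_left_limit (\<lambda>r. X r \<omega>) t L"
proof -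
  obtain R where "\<forall>\<^sub>F r in at t within {r\<in>\<rat>. 0 \<le> r \<and> r < t}.
    closed (X r \<omega>) \<and> convex (X r \<omega>) \<and> X r \<omega> \<noteq> {} \<and> X r \<omega> \<subseteq> cball 0 R"
    using regular_eventually_left[OF assms] by blast
  from hausdorff_limit_exists_if_real_support_convergent[OF at_left_rats_neq_bot[OF assms] W(2) this]
  show ?thesis unfolding has_left_limit_def using regular_support_left_limit[OF _ assms] by blast
qed

lemma regular_right_limit:
  assumes "0 \<le> t"
  shows "\<exists>L. has_right_limit (\<lambda>r. X r \<omega>) t L"
proof -
  obtain T :: nat where T: "t < T" using reals_Archimedean2 by blast
  obtain R where R: "\<forall>q\<in>\<rat> \<inter> {0..real T}.
    closed (X q \<omega>) \<and> convex (X q \<omega>) \<and> X q \<omega> \<noteq> {} \<and> X q \<omega> \<subseteq> cball 0 R"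
    using regular_bounded by blast
  have "\<forall>\<^sub>F r in at t within {r\<in>\<rat>. t < r}. r < T"
    by (rule order_tendstoD(2)[OF tendsto_ident_at T])
  moreover have "\<forall>\<^sub>F r in at t within {r\<in>\<rat>. t < r}. r \<in> {r\<in>\<rat>. t < r}"
    by (simp add: eventually_at_filter)
  ultimately have ev: "\<forall>\<^sub>F r in at t within {r\<in>\<rat>. t < r}.
    closed (X r \<omega>) \<and> convex (X r \<omega>) \<and> X r \<omega> \<noteq> {} \<and> X r \<omega> \<subseteq> cball 0 R"
    by eventually_elim (use R assms in auto)
  have "\<exists>l. ((\<lambda>r. real_support x (X r \<omega>)) \<longlongrightarrow> l) (at t within {r\<in>\<rat>. t < r})" if x: "x \<in> W" for x
  proof -
    obtain B where "\<forall>q\<in>\<rat> \<inter> {0..real T}. \<bar>real_support x (X q \<omega>)\<bar> \<le> B"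
      using regular_support_bounded by blast
    then show ?thesis
      using regular_finite_upcrossings[OF x]
      by (intro right_limit_if_finite_upcrossings[OF assms T]) auto
  qed
  then show ?thesis unfolding has_right_limit_def
    using hausdorff_limit_exists_if_real_support_convergent[OF at_right_rats_neq_bot W(2) ev] by blast
qed

end

text \<open>The null set comes from an L1-convergent sequence chosen for this t, so the statement
  holds for each fixed t and not for all t together. Regularity supplies the existence of the
  limits, and L1 continuity identifies them in the countably many directions of
  \<open>W\<close>.\<close>

lemma AE_left_limit:
  assumes "0 < t"
  shows "AE \<omega> in M. has_left_limit (\<lambda>r. X r \<omega>) t (X t \<omega>)"
proof -
  have "AE \<omega> in M. \<forall>x\<in>W. \<forall>l. ((\<lambda>r. real_support x (X r \<omega>)) \<longlongrightarrow> l) (at t within {r\<in>\<rat>. 0 \<le> r \<and> r < t})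
      \<longrightarrow> l = real_support x (X t \<omega>)"
    using AE_left_limit_eq[OF prob_space_axioms filtration left_cont support_submartingale assms]
      expectation_support_left_continuous[OF _ assms]
    by (simp add: AE_ball_countable W(1))
  moreover have "AE \<omega> in M. bounded (X t \<omega>)"
    using convex_bounded_set_rv.AE_bounded[OF convex_bounded_rv] assms by simp
  ultimately show ?thesis using AE_regular
  proof eventually_elim
    case (elim \<omega>)
    obtain R where R: "\<forall>\<^sub>F r in at t within {r\<in>\<rat>. 0 \<le> r \<and> r < t}.
      closed (X r \<omega>) \<and> convex (X r \<omega>) \<and> X r \<omega> \<noteq> {} \<and> X r \<omega> \<subseteq> cball 0 R"
      using regular_eventually_left[OF elim(3) assms] by blast
    have Xt: "closed (X t \<omega>)" "X t \<omega> \<noteq> {}" "convex (X t \<omega>)"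
      using closed_nonempty_convex[of t, OF _ regular_space[OF elim(3)]] assms by auto
    have "((\<lambda>r. real_support x (X r \<omega>)) \<longlongrightarrow> real_support x (X t \<omega>)) (at t within {r\<in>\<rat>. 0 \<le> r \<and> r < t})"
      if "x \<in> W" for x
      using regular_support_left_limit[OF elim(3) that assms] elim(1) that by blast
    then show ?case unfolding has_left_limit_def
      by (intro hausdorff_tendsto_if_real_support_tendsto[OF W(2) R Xt(1,3,2) elim(2)])
  qed
qed

text \<open>Built from \<open>X\<close> at rational times alone when t > 0; at t = 0 there is no
  left limit and \<open>X\<close> is kept. The value {0} on irregular paths and the convexity inside
  the choice ensure that all values are closed, nonempty and convex on the whole space, not just
  almost surely.\<close>

definition modification :: "real \<Rightarrow> 'w \<Rightarrow> 'a set" where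
  "modification t \<omega> =
     (if t \<le> 0 then X t \<omega>
      else if \<exists>L. convex L \<and> has_left_limit (\<lambda>r. X r \<omega>) t L
      then SOME L. convex L \<and> has_left_limit (\<lambda>r. X r \<omega>) t L
      else {0})"

lemma modification_closed_nonempty_convex:
  assumes "0 \<le> t" "\<omega> \<in> space M"
  shows "closed (modification t \<omega>) \<and> modification t \<omega> \<noteq> {} \<and> convex (modification t \<omega>)"
proof (cases "0 < t \<and> (\<exists>L. convex L \<and> has_left_limit (\<lambda>r. X r \<omega>) t L)")
  case True
  from someI_ex[OF conjunct2[OF True]] show ?thesis
    using True by (auto simp: modification_def has_left_limit_def hausdorff_tendsto_def)
next
  case False
  then show ?thesis using closed_nonempty_convex[OF assms] by (auto simp: modification_def)
qed

lemma modification_left_limit: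
  assumes "regular \<omega>" "0 < t"
  shows "has_left_limit (\<lambda>r. X r \<omega>) t (modification t \<omega>)"
  using someI_ex[OF regular_left_limit[OF assms]] regular_left_limit[OF assms] assms(2)
  by (auto simp: modification_def)

lemma AE_modification_eq:
  assumes "0 \<le> t"
  shows "AE \<omega> in M. X t \<omega> = modification t \<omega>"
proof (cases "t = 0")
  case True
  then show ?thesis by (simp add: modification_def)
next
  case False
  then have "0 < t" using assms by simp
  from AE_left_limit[OF this] AE_regular show ?thesis
  proof eventually_elim
    case (elim \<omega>)
    have "\<forall>\<^sub>F r in at t within {r\<in>\<rat>. 0 \<le> r \<and> r < t}. X r \<omega> \<noteq> {}"
      using closed_nonempty_convex[OF _ regular_space[OF elim(2)]] by (auto simp: eventually_at_filter)
    with elim(1) modification_left_limit[OF elim(2) \<open>0 < t\<close>] show ?case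
      unfolding has_left_limit_def by (rule hausdorff_tendsto_unique[OF at_left_rats_neq_bot[OF \<open>0 < t\<close>]])
  qed
qed

text \<open>Limits are taken along the rationals, and at all nonnegative rational times together the
  modification agrees with \<open>X\<close> outside one null set. So both have the same one-sided
  limits at every t, and the left one is the modification by construction.\<close>

lemma AE_modification_caglad:
  "AE \<omega> in M. (\<forall>t>0. has_left_limit (\<lambda>r. modification r \<omega>) t (modification t \<omega>)) \<and>
     (\<forall>t\<ge>0. \<exists>L. has_right_limit (\<lambda>r. modification r \<omega>) t L)"
proof -
  have "AE \<omega> in M. \<forall>r\<in>\<rat> \<inter> {0..}. X r \<omega> = modification r \<omega>"
    using AE_modification_eq by (subst AE_ball_countable) (auto simp: countable_rat)
  with AE_regular show ?thesis
  proof eventually_elim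
    case (elim \<omega>)
    have eq: "X r \<omega> = modification r \<omega>" if "r \<in> \<rat>" "0 \<le> r" for r using elim(2) that by auto
    have "has_left_limit (\<lambda>r. modification r \<omega>) t (modification t \<omega>)" if "0 < t" for t
      using modification_left_limit[OF elim(1) that] has_left_limit_cong[OF eq] by simp
    moreover have "\<exists>L. has_right_limit (\<lambda>r. modification r \<omega>) t L" if "0 \<le> t" for t
      using regular_right_limit[OF elim(1) that] has_right_limit_cong[OF eq that] by simp
    ultimately show ?case by blast
  qed
qed

text \<open>The choice operator gives no direct access to measurability. It is inherited from
  \<open>X t\<close> through almost sure equality, and this is where augmentation enters.\<close>

lemma modification_adapted:
  assumes "augmented M F"
  shows "adapted_set_process F modification"
  unfolding adapted_set_process_def
proof (intro allI impI)
  fix t :: real assume t: "0 \<le> t"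
  show "set_random_variable (F t) (modification t)"
  proof (rule set_random_variable_cong_AE[OF _ _ _ _ AE_modification_eq[OF t]])
    show "complete_measure M" using assms by (simp add: augmented_def)
    have "sets (F 0) \<subseteq> sets (F t)" using filtration t by (simp add: filtration_nonneg_def)
    then show "null_sets M \<subseteq> sets (F t)" using assms by (auto simp: augmented_def)
    show "subalgebra M (F t)" using filtration t by (simp add: filtration_nonneg_def)
    show "set_random_variable (F t) (X t)"
      using submartingale t by (simp add: set_submartingale_def adapted_set_process_def)
    show "closed (modification t \<omega>) \<and> modification t \<omega> \<noteq> {}" if "\<omega> \<in> space M" for \<omega>
      using modification_closed_nonempty_convex[OF t that] by blast
  qed
qed

lemma modification_integrably_bounded: "integrably_bounded_set_process M modification"
  unfolding integrably_bounded_set_process_def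
proof (intro allI impI)
  fix t :: real assume t: "0 \<le> t"
  have "AE \<omega> in M. set_norm (X t \<omega>) = set_norm (modification t \<omega>)"
    using AE_modification_eq[OF t] by eventually_elim simp
  then have "(\<integral>\<^sup>+\<omega>. set_norm (X t \<omega>) \<partial>M) = (\<integral>\<^sup>+\<omega>. set_norm (modification t \<omega>) \<partial>M)"
    by (rule nn_integral_cong_AE)
  moreover have "(\<integral>\<^sup>+\<omega>. set_norm (X t \<omega>) \<partial>M) < \<infinity>"
    using bounded_X t by (simp add: integrably_bounded_set_process_def integrably_bounded_rv_def)
  ultimately show "integrably_bounded_rv M (modification t)" by (simp add: integrably_bounded_rv_def)
qed

end

theorem corollary4p7:
  fixes M :: "'w measure"
    and F :: "real \<Rightarrow> 'w measure"
    and W :: "'a::euclidean_space set"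
    and X :: "real \<Rightarrow> 'w \<Rightarrow> 'a set"
  assumes "prob_space M"
    and "filtration_nonneg M F"
    and "augmented M F"
    and "left_continuous_filtration M F"
    and "countable W" and "W \<subseteq> cball 0 1" and "cball 0 1 \<subseteq> closure W" and "0 \<notin> W"
    and "set_submartingale M F X"
    and "convex_set_process M X"
    and "integrably_bounded_set_process M X"
    and "\<forall>x\<in>W. \<forall>t>0. continuous (at_left t) (\<lambda>r. support_fun x (set_expectation M (X r)))"
  shows "\<exists>X' :: real \<Rightarrow> 'w \<Rightarrow> 'a set.
           set_submartingale M F X' \<and>
           convex_set_process M X' \<and>
           integrably_bounded_set_process M X' \<and>
           (\<forall>t\<ge>0. AE \<omega> in M. X t \<omega> = X' t \<omega>) \<and>
           (AE \<omega> in M.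
              (\<forall>t>0. has_left_limit (\<lambda>r. X' r \<omega>) t (X' t \<omega>)) \<and>
              (\<forall>t\<ge>0. \<exists>L. has_right_limit (\<lambda>r. X' r \<omega>) t L)) \<and>
           (set_martingale M F X \<longrightarrow> set_martingale M F X')"
proof -
  interpret left_continuous_set_submartingale M F W X
    using assms(1,2,4,5,7,9-12)
    by (intro left_continuous_set_submartingale.intro left_continuous_set_submartingale_axioms.intro) blast+
  note adapted = modification_adapted[OF assms(3)]
  show ?thesis
  proof (intro exI[of _ modification] conjI allI impI)
    show "set_submartingale M F modification"
      by (rule set_submartingale_cong_AE[OF submartingale adapted AE_modification_eq])
    show "convex_set_process M modification"
      using modification_closed_nonempty_convex by (simp add: convex_set_process_def)
    show "set_martingale M F modification" if "set_martingale M F X"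
      by (rule set_martingale_cong_AE[OF that adapted AE_modification_eq])
  qed (fact modification_integrably_bounded AE_modification_eq AE_modification_caglad)+
qed

end
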